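(* Let $\mathcal G=(V,E,\mathcal B)$ be a locally finite Borel graph admitting a Borel transversal $X\subseteq V$. Let $\ell:V\to\omega$ be a Borel labelling, $n\in\omega$, and $\mathsf C$ be an LCL. If there is an assignment $V\to n$ that solves $\mathsf C$ on $(\mathcal G,\ell)$, then there is a Borel assignment $V\to n$ that solves $\mathsf C$ on $(\mathcal G,\ell)$.
   Context: A Borel graph is a triple $(V,E,\mathcal B)$ where $(V,\mathcal B)$ is a standard Borel space, $E\subseteq V^2$ is symmetric, disjoint from the diagonal, and Borel in $V^2$; locally finite means all neighbourhoods are finite. A transversal is a set containing exactly one vertex from each connectivity component. A labelling/assignment into a countable set is Borel if all preimages are Borel; $n$ is identified with $\{0,\dots,n-1\}$. For a graph $G$ with labelling $\lambda$ into a countable set, a local rule of radius $r$ is a function on $V$ whose value at $x$ depends only on the isomorphism type of the rooted labelled graph induced on the vertices at distance at most $r$ from $x$ (with the restricted labelling and root $x$). An LCL (locally checkable labelling problem) is a $\{0,1\}$-valued local rule $\mathsf C$ (of some fixed radius) defined for graphs with $\omega^2$-valued labellings. An assignment $a:V\to\omega$ solves $\mathsf C$ on $(G,\ell)$ if $\mathsf C$ evaluated on the labelled graph $(G,(\ell,a))$, where $(\ell,a)(x)=(\ell(x),a(x))$, returns $1$ at every vertex. *)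

theory Defs
  imports "HOL-Analysis.Analysis"
begin

text \<open>
  A measurable space is represented by a value of type \<^typ>\<open>'a measure\<close>, of which only
  \<^const>\<open>space\<close> and \<^const>\<open>sets\<close> are used; the measure it carries is irrelevant.
\<close>

definition standard_borel :: "'a measure \<Rightarrow> bool" where
  "standard_borel M \<longleftrightarrow>
     (\<exists>T. topspace T = space M \<and> completely_metrizable_space T \<and> separable_space T \<and>
          sets M = sigma_sets (space M) {U. openin T U})"

definition simple_graph :: "'a set \<Rightarrow> 'a rel \<Rightarrow> bool" where
  "simple_graph V E \<longleftrightarrow> E \<subseteq> V \<times> V \<and> sym E \<and> irrefl E"

definition borel_graph :: "'a measure \<Rightarrow> 'a rel \<Rightarrow> bool" where
  "borel_graph M E \<longleftrightarrow>
     standard_borel M \<and> simple_graph (space M) E \<and> E \<in> sets (M \<Otimes>\<^sub>M M)"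

definition locally_finite :: "'a set \<Rightarrow> 'a rel \<Rightarrow> bool" where
  "locally_finite V E \<longleftrightarrow> (\<forall>x\<in>V. finite (E `` {x}))"

definition graph_components :: "'a set \<Rightarrow> 'a rel \<Rightarrow> 'a set set" where
  "graph_components V E = V // {(x, y) \<in> V \<times> V. (x, y) \<in> E\<^sup>*}"

definition transversal :: "'a set \<Rightarrow> 'a rel \<Rightarrow> 'a set \<Rightarrow> bool" where
  "transversal V E X \<longleftrightarrow> X \<subseteq> V \<and> (\<forall>K \<in> graph_components V E. \<exists>!x. x \<in> X \<inter> K)"

text \<open>The distance between vertices of different components is \<open>\<infinity>\<close>, the infimum of the empty set.\<close>

definition graph_dist :: "'a rel \<Rightarrow> 'a \<Rightarrow> 'a \<Rightarrow> enat" where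
  "graph_dist E x y = Inf {enat k |k. (x, y) \<in> E ^^ k}"

definition graph_ball :: "'a set \<Rightarrow> 'a rel \<Rightarrow> nat \<Rightarrow> 'a \<Rightarrow> 'a set" where
  "graph_ball V E r x = {y \<in> V. graph_dist E x y \<le> enat r}"

definition rooted_labelled_iso ::
  "'a set \<Rightarrow> 'a rel \<Rightarrow> ('a \<Rightarrow> 'l) \<Rightarrow> 'a \<Rightarrow> 'b set \<Rightarrow> 'b rel \<Rightarrow> ('b \<Rightarrow> 'l) \<Rightarrow> 'b \<Rightarrow> bool" where
  "rooted_labelled_iso V E lab x V' E' lab' x' \<longleftrightarrow>
     (\<exists>f. bij_betw f V V' \<and> f x = x' \<and>
          (\<forall>u\<in>V. \<forall>v\<in>V. (u, v) \<in> E \<longleftrightarrow> (f u, f v) \<in> E') \<and>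
          (\<forall>u\<in>V. lab' (f u) = lab u))"

text \<open>
  A rule takes a vertex set, an edge relation, a labelling and a vertex, and returns its value at
  that vertex. It is given on all graphs with vertices in the type \<^typ>\<open>'a\<close>; since the value is
  determined by the isomorphism type of the ball, it does not depend on the labels outside the
  vertex set, and a rule for graphs on arbitrary sets restricts to a rule of this kind.
\<close>

type_synonym ('a, 'l, 'v) rule = "'a set \<Rightarrow> 'a rel \<Rightarrow> ('a \<Rightarrow> 'l) \<Rightarrow> 'a \<Rightarrow> 'v"

definition local_rule :: "nat \<Rightarrow> ('a, 'l, 'v) rule \<Rightarrow> bool" where
  "local_rule r R \<longleftrightarrow>
     (\<forall>V E lab x V' E' lab' x'.
        simple_graph V E \<longrightarrow> simple_graph V' E' \<longrightarrow> x \<in> V \<longrightarrow> x' \<in> V' \<longrightarrow>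
        (let B = graph_ball V E r x; B' = graph_ball V' E' r x' in
           rooted_labelled_iso B (E \<inter> B \<times> B) lab x B' (E' \<inter> B' \<times> B') lab' x') \<longrightarrow>
        R V E lab x = R V' E' lab' x')"

text \<open>The values \<open>0\<close> and \<open>1\<close> of the rule are \<^const>\<open>False\<close> and \<^const>\<open>True\<close>.\<close>

definition LCL :: "('a, nat \<times> nat, bool) rule \<Rightarrow> bool" where
  "LCL C \<longleftrightarrow> (\<exists>r. local_rule r C)"

definition solves ::
  "('a, nat \<times> nat, bool) rule \<Rightarrow> 'a set \<Rightarrow> 'a rel \<Rightarrow> ('a \<Rightarrow> nat) \<Rightarrow> ('a \<Rightarrow> nat) \<Rightarrow> bool" where
  "solves C V E l a \<longleftrightarrow> (\<forall>x\<in>V. C V E (\<lambda>y. (l y, a y)) x)"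

end

theory Submission
  imports Defs
begin

text \<open>
  By the Lusin--Novikov theorem for sets with finite sections, the edge relation is covered by the
  graphs of countably many Borel maps; composing them gives Borel maps that enumerate the component
  of every vertex, starting from its representative in the transversal. For a representative \<open>z\<close>,
  the solutions on its component become the infinite branches of an \<open>n\<close>-branching tree of partial
  assignments. The tree depends on \<open>z\<close> in a Borel way, because each of its nodes only involves
  finitely many vertices and hence one of countably many isomorphism types. By Koenig's lemma a node
  lies on a branch iff it has descendants on every level, which is a Borel condition, so the leftmost
  branch is Borel in \<open>z\<close>.

  Lusin--Novikov is obtained from Novikov's separation theorem: if \<open>P\<close> has finite sections,
  every point \<open>(x, y)\<close> of \<open>P\<close> has a basic open set in which \<open>y\<close> is the only member of the section
  over \<open>x\<close>. For each fixed basic open set this condition is coanalytic in \<open>P\<close>, and separation shrinks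
  this countable coanalytic cover of \<open>P\<close> to a Borel one, consisting of graphs of partial functions.
\<close>

section \<open>Analytic sets and Novikov separation\<close>

instance "fun" :: (type, t0_space) t0_space
proof
  fix f g :: "'a \<Rightarrow> 'b"
  assume "f \<noteq> g"
  then obtain i where "f i \<noteq> g i" by auto
  then obtain U where "open U" "(f i \<in> U) \<noteq> (g i \<in> U)"
    using separation_t0[of "f i" "g i"] by auto
  then show "\<exists>U. open U \<and> \<not> (f \<in> U \<longleftrightarrow> g \<in> U)"
    by (intro exI[of _ "(\<lambda>h. h i) -` U"]) (auto intro!: open_vimage)
qed

instance "fun" :: (type, t1_space) t1_space
proof
  fix f g :: "'a \<Rightarrow> 'b"
  assume "f \<noteq> g"
  then obtain i where "f i \<noteq> g i" by auto
  then obtain U where "open U" "f i \<in> U" "g i \<notin> U"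
    using separation_t1[of "f i" "g i"] by auto
  then show "\<exists>U. open U \<and> f \<in> U \<and> g \<notin> U"
    by (intro exI[of _ "(\<lambda>h. h i) -` U"]) (auto intro!: open_vimage)
qed

text \<open>Distinct functions differ at one coordinate, and preimages under that projection
  separate them. Hence \<open>baire\<close> and its products are Hausdorff, as the separation
  theorems require.\<close>

instance "fun" :: (type, t2_space) t2_space
proof
  fix f g :: "'a \<Rightarrow> 'b"
  assume "f \<noteq> g"
  then obtain i where "f i \<noteq> g i" by auto
  then obtain U V where UV: "open U" "open V" "f i \<in> U" "g i \<in> V" "U \<inter> V = {}"
    by (meson hausdorff)
  have "open ((\<lambda>h::'a \<Rightarrow> 'b. h i) -` U)" "open ((\<lambda>h::'a \<Rightarrow> 'b. h i) -` V)"
    using UV by (auto intro!: open_vimage)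
  then show "\<exists>U V. open U \<and> open V \<and> f \<in> U \<and> g \<in> V \<and> U \<inter> V = {}"
    using UV by (intro exI[of _ "(\<lambda>h. h i) -` U"] exI[of _ "(\<lambda>h. h i) -` V"]) auto
qed

section \<open>Baire space and its cylinder sets\<close>

type_synonym baire = "nat \<Rightarrow> nat"

definition cyl :: "nat list \<Rightarrow> baire set" where
  "cyl s = {y. \<forall>i<length s. y i = s ! i}"

lemma open_cyl: "open (cyl s)" and closed_cyl: "closed (cyl s)"
proof -
  have eq: "cyl s = (\<Inter>i\<in>{..<length s}. (\<lambda>y. y i) -` {s ! i})"
    by (auto simp: cyl_def)
  show "open (cyl s)"
    unfolding eq by (intro open_INT ballI open_vimage) (auto simp: open_discrete)
  show "closed (cyl s)"
    unfolding eq by (intro closed_INT ballI closed_vimage) auto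
qed

text \<open>A basic open set of the product constrains only finitely many coordinates, so an initial
  segment long enough to include them all forces membership.\<close>

lemma open_contains_cyl:
  fixes x :: baire
  assumes "open U" "x \<in> U"
  obtains m where "cyl (map x [0..<m]) \<subseteq> U"
proof -
  obtain X where X: "x \<in> Pi\<^sub>E UNIV X" "finite {i. X i \<noteq> UNIV}" "Pi\<^sub>E UNIV X \<subseteq> U"
    using product_topology_open_contains_basis[of "\<lambda>_. euclidean" UNIV U x] assms
    by (auto simp: open_fun_def)
  obtain m where m: "\<And>i. X i \<noteq> UNIV \<Longrightarrow> i < m"
    using X(2) unfolding finite_nat_set_iff_bounded by auto
  have "y \<in> Pi\<^sub>E UNIV X" if "y \<in> cyl (map x [0..<m])" for y
  proof (clarsimp simp: PiE_iff)
    fix i show "y i \<in> X i"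
      using that X(1) m[of i] by (cases "i < m") (auto simp: cyl_def PiE_iff)
  qed
  with X(3) have "cyl (map x [0..<m]) \<subseteq> U" by blast
  then show ?thesis by (rule that)
qed

text \<open>\<open>F\<close> may be empty, which admits the empty set. A nonempty closed subset of
  Baire space is a retract of it, so asking for continuity of \<open>h\<close> everywhere loses
  nothing.\<close>

definition analytic :: "'b::topological_space set \<Rightarrow> bool" where
  "analytic A \<longleftrightarrow> (\<exists>(F :: baire set) h. closed F \<and> continuous_on UNIV h \<and> A = h ` F)"

lemma analytic_image:
  assumes "analytic A" "continuous_on UNIV g"
  shows "analytic (g ` A)"
proof -
  obtain F h where "closed (F :: baire set)" "continuous_on UNIV h" "A = h ` F"
    using assms(1) by (auto simp: analytic_def)
  then show ?thesis
    unfolding analytic_def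
    by (intro exI[of _ F] exI[of _ "g \<circ> h"])
       (auto intro!: continuous_on_compose2[OF assms(2)])
qed

text \<open>The first digit of a code selects the set \<open>A i\<close>, and the tail codes a point
  of it.\<close>

lemma analytic_UN:
  fixes A :: "nat \<Rightarrow> 'b::topological_space set"
  assumes "\<And>i. analytic (A i)"
  shows "analytic (\<Union>i. A i)"
proof -
  have "\<forall>i. \<exists>F h. closed (F :: baire set) \<and> continuous_on UNIV h \<and> A i = h ` F"
    using assms by (auto simp: analytic_def)
  then obtain F h where Fh: "\<And>i. closed (F i :: baire set)" "\<And>i. continuous_on UNIV (h i)"
    "\<And>i. A i = h i ` F i" by metis
  define tail :: "baire \<Rightarrow> baire" where "tail = (\<lambda>c j. c (Suc j))"
  have ct: "continuous_on UNIV tail"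
    unfolding tail_def by (intro continuous_on_coordinatewise_then_product) simp
  define G where "G = (\<Inter>i. (\<lambda>c::baire. c 0) -` (- {i}) \<union> tail -` F i)"
  have G: "G = {c. tail c \<in> F (c 0)}"
    by (auto simp: G_def)
  have cG: "closed G"
    unfolding G_def using Fh(1) ct
    by (intro closed_INT ballI closed_Un closed_vimage) (auto simp: closed_def open_discrete)
  define k where "k = (\<lambda>c. h (c 0) (tail c))"
  \<comment> \<open>\<open>k\<close> is glued from the maps \<open>h i\<close> along the open pieces
    on which the first digit is \<open>i\<close>.\<close>
  have ck: "continuous_on UNIV k"
  proof (subst continuous_on_open_vimage, simp, intro allI impI)
    fix B :: "'b set" assume "open B"
    have "k -` B \<inter> UNIV = (\<Union>i. (\<lambda>c::baire. c 0) -` {i} \<inter> tail -` (h i -` B))"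
      by (auto simp: k_def)
    also have "open \<dots>"
      using \<open>open B\<close> ct Fh(2)
      by (intro open_UN ballI open_Int open_vimage) (auto simp: open_discrete)
    finally show "open (k -` B \<inter> UNIV)" .
  qed
  have "(\<Union>i. A i) = k ` G"
  proof (rule set_eqI, rule iffI)
    fix x assume "x \<in> (\<Union>i. A i)"
    then obtain i f where "x = h i f" "f \<in> F i" using Fh(3) by auto
    then show "x \<in> k ` G"
      by (intro image_eqI[of _ _ "case_nat i f"]) (auto simp: G k_def tail_def)
  qed (use Fh(3) in \<open>auto simp: G k_def\<close>)
  with cG ck show ?thesis unfolding analytic_def by blast
qed

lemma analytic_Un:
  assumes "analytic A" "analytic B"
  shows "analytic (A \<union> B)"
proof -
  have "analytic (\<Union>i::nat. if i = 0 then A else B)"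
    using assms by (intro analytic_UN) auto
  moreover have "(\<Union>i::nat. if i = 0 then A else B) = A \<union> B"
    by (auto split: if_splits)
  ultimately show ?thesis by simp
qed

text \<open>Row \<open>i\<close> of a code that the pairing function turns into an infinite matrix:
  one point of Baire space carries countably many of them.\<close>

definition strand :: "nat \<Rightarrow> baire \<Rightarrow> baire" where
  "strand i c j = c (prod_encode (i, j))"

lemma continuous_on_strand [continuous_intros]: "continuous_on S (strand i)"
  by (rule continuous_on_subset[of UNIV], rule continuous_on_coordinatewise_then_product)
     (auto simp: strand_def)

lemma strands_surj: "\<exists>c. \<forall>i. strand i c = f i"
proof
  show "\<forall>i. strand i (\<lambda>n. case prod_decode n of (i, j) \<Rightarrow> f i j) = f i"
    by (auto simp: strand_def)
qed

text \<open>A point of the intersection is coded by one code for each \<open>A i\<close>, all with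
  the same image. In a Hausdorff space these equations between images are closed conditions.\<close>

lemma analytic_INT:
  fixes A :: "nat \<Rightarrow> 'b::t2_space set"
  assumes "\<And>i. analytic (A i)"
  shows "analytic (\<Inter>i. A i)"
proof -
  have "\<forall>i. \<exists>F h. closed (F :: baire set) \<and> continuous_on UNIV h \<and> A i = h ` F"
    using assms by (auto simp: analytic_def)
  then obtain F h where Fh: "\<And>i. closed (F i :: baire set)" "\<And>i. continuous_on UNIV (h i)"
    "\<And>i. A i = h i ` F i" by metis
  have ch: "continuous_on UNIV (\<lambda>c. h i (strand i c))" for i
    using continuous_on_compose2[OF Fh(2)[of i] continuous_on_strand[of UNIV i]] by simp
  define G where "G = (\<Inter>i. strand i -` F i \<inter> {c. h i (strand i c) = h 0 (strand 0 c)})"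
  have "closed G"
    unfolding G_def using Fh(1) ch
    by (intro closed_INT ballI closed_Int closed_vimage closed_Collect_eq)
       (auto intro!: continuous_intros)
  moreover have "(\<Inter>i. A i) = (\<lambda>c. h 0 (strand 0 c)) ` G"
  proof (rule set_eqI, rule iffI)
    fix x assume "x \<in> (\<Inter>i. A i)"
    then have "\<forall>i. \<exists>f. x = h i f \<and> f \<in> F i" using Fh(3) by auto
    then obtain f where f: "\<And>i. x = h i (f i)" "\<And>i. f i \<in> F i" by metis
    obtain c where "\<And>i. strand i c = f i"
      using strands_surj[of f] by blast
    with f show "x \<in> (\<lambda>c. h 0 (strand 0 c)) ` G"
      by (intro image_eqI[of _ _ c]) (auto simp: G_def simp flip: f(1))
  next
    fix x assume "x \<in> (\<lambda>c. h 0 (strand 0 c)) ` G"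
    then obtain c where "c \<in> G" "x = h 0 (strand 0 c)" by auto
    then have "x = h i (strand i c) \<and> strand i c \<in> F i" for i
      unfolding G_def by (metis (mono_tags, lifting) INT_E IntE UNIV_I mem_Collect_eq vimageD)
    then show "x \<in> (\<Inter>i. A i)" using Fh(3) by blast
  qed
  ultimately show ?thesis unfolding analytic_def using ch by blast
qed

section \<open>Borel sets are analytic\<close>

lemma analytic_closed: "closed (F :: baire set) \<Longrightarrow> analytic F"
  unfolding analytic_def by (intro exI[of _ F] exI[of _ id]) auto

text \<open>An open set is the union of the cylinders inside it; there are countably many, and each
  is closed.\<close>

lemma analytic_open:
  assumes "open (U :: baire set)"
  shows "analytic U"
proof -
  define A where "A = (\<lambda>n. let s = from_nat n in if cyl s \<subseteq> U then cyl s else {})"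
  have "analytic (A n)" for n
    unfolding A_def Let_def by (auto intro!: analytic_closed closed_cyl)
  moreover have "(\<Union>n. A n) = U"
  proof (rule set_eqI, rule iffI)
    fix x assume "x \<in> U"
    with assms obtain m where "cyl (map x [0..<m]) \<subseteq> U" by (rule open_contains_cyl)
    then have "x \<in> A (to_nat (map x [0..<m]))" by (auto simp: A_def cyl_def)
    then show "x \<in> (\<Union>n. A n)" by blast
  qed (auto simp: A_def Let_def split: if_splits)
  ultimately show ?thesis using analytic_UN[of A] by simp
qed

text \<open>The induction carries the complement along: complementation then only swaps the two
  claims, and a union needs closure under both countable unions and countable intersections.\<close>

lemma analytic_borel_baire:
  assumes "A \<in> sets (borel :: baire measure)"
  shows "analytic A"
proof -
  have "A \<in> sigma_sets UNIV (Collect open)"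
    using assms by (simp add: borel_def)
  then have "analytic A \<and> analytic (- A)"
  proof induction
    case (Basic a)
    then show ?case by (auto intro: analytic_open analytic_closed)
  next
    case (Union a)
    then show ?case using analytic_UN[of a] analytic_INT[of "\<lambda>i. - a i"] by auto
  qed (auto intro: analytic_closed simp: Compl_eq_Diff_UNIV[symmetric])
  then show ?thesis by simp
qed

text \<open>Pull the set back to Baire space and push it forward again. Tuples of strands supply the
  continuous surjections onto pairs and triples.\<close>

lemma analytic_borel:
  fixes s :: "baire \<Rightarrow> 'b::topological_space" and A :: "'b set"
  assumes "continuous_on UNIV s" "surj s" "A \<in> sets borel"
  shows "analytic A"
proof -
  have "s -` A \<in> sets borel"
    using measurable_sets[OF borel_measurable_continuous_onI[OF assms(1)] assms(3)] by simp
  then have "analytic (s ` (s -` A))"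
    by (intro analytic_image[OF analytic_borel_baire] assms(1))
  with assms(2) show ?thesis by (simp add: surj_image_vimage_eq)
qed

lemma analytic_borel_pair:
  assumes "A \<in> sets (borel :: (baire \<times> baire) measure)"
  shows "analytic A"
proof (rule analytic_borel[OF _ _ assms])
  show "continuous_on UNIV (\<lambda>c. (strand 0 c, strand 1 c))" by (intro continuous_intros)
  show "surj (\<lambda>c. (strand 0 c, strand 1 c))"
  proof (unfold surj_def, clarify)
    fix x y :: baire
    obtain c where "\<And>i. strand i c = (if i = 0 then x else y)"
      using strands_surj[of "\<lambda>i. if i = 0 then x else y"] by blast
    then show "\<exists>c. (x, y) = (strand 0 c, strand 1 c)" by (intro exI[of _ c]) auto
  qed
qed

lemma analytic_borel_triple:
  assumes "A \<in> sets (borel :: (baire \<times> baire \<times> baire) measure)"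
  shows "analytic A"
proof (rule analytic_borel[OF _ _ assms])
  show "continuous_on UNIV (\<lambda>c. (strand 0 c, strand 1 c, strand 2 c))" by (intro continuous_intros)
  show "surj (\<lambda>c. (strand 0 c, strand 1 c, strand 2 c))"
  proof (unfold surj_def, clarify)
    fix x y z :: baire
    obtain c where "\<And>i. strand i c = (if i = 0 then x else if i = 1 then y else z)"
      using strands_surj[of "\<lambda>i. if i = 0 then x else if i = 1 then y else z"] by blast
    then show "\<exists>c. (x, y, z) = (strand 0 c, strand 1 c, strand 2 c)" by (intro exI[of _ c]) auto
  qed
qed

section \<open>Novikov and Lusin separation\<close>

definition borel_separable :: "(nat \<Rightarrow> 'b::topological_space set) \<Rightarrow> bool" where
  "borel_separable A \<longleftrightarrow>
     (\<exists>B. (\<forall>i. B i \<in> sets borel \<and> A i \<subseteq> B i) \<and> (\<Inter>i. B i) = {})"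

text \<open>All other members are enclosed in the whole space. The case \<open>i = j\<close> is
  allowed and covers a sequence with an empty member.\<close>

lemma borel_separableI:
  assumes "U \<in> sets borel" "V \<in> sets borel" "A i \<subseteq> U" "A j \<subseteq> V" "U \<inter> V = {}"
  shows "borel_separable A"
proof -
  define B where "B k = (if k = i then U else UNIV) \<inter> (if k = j then V else UNIV)" for k
  have "B k \<in> sets borel" "A k \<subseteq> B k" for k
    using assms(1-4) by (auto simp: B_def)
  moreover have "B i \<subseteq> U" "B j \<subseteq> V" by (auto simp: B_def)
  then have "(\<Inter>k. B k) = {}" using assms(5) by blast
  ultimately show ?thesis unfolding borel_separable_def by blast
qed

text \<open>Take the union of the given separators in place \<open>i\<close> and their intersection
  in every other place. Read contrapositively: if a sequence is inseparable, it remains so for some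
  piece \<open>A' k\<close> put in place of \<open>A i\<close>.\<close>

lemma borel_separable_split:
  assumes "A i = (\<Union>k::nat. A' k)" "\<And>k. borel_separable (A(i := A' k))"
  shows "borel_separable A"
proof -
  have "\<forall>k. \<exists>B. (\<forall>j. B j \<in> sets borel \<and> (A(i := A' k)) j \<subseteq> B j) \<and> (\<Inter>j. B j) = {}"
    using assms(2) by (auto simp: borel_separable_def)
  then obtain B where B: "\<And>k j. B k j \<in> sets borel" "\<And>k j. (A(i := A' k)) j \<subseteq> B k j"
    "\<And>k. (\<Inter>j. B k j) = {}" by metis
  define D where "D = (\<lambda>j. if j = i then (\<Union>k. B k i) else (\<Inter>k. B k j))"
  have "D j \<in> sets borel" for j
    using B(1) by (auto simp: D_def)
  moreover have "A j \<subseteq> D j" for j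
  proof (cases "j = i")
    case True
    have "A' k \<subseteq> B k i" for k using B(2)[of k i] by simp
    then show ?thesis using True by (auto simp: D_def assms(1))
  next
    case False
    have "A j \<subseteq> B k j" for k using B(2)[of k j] False by simp
    then show ?thesis using False by (auto simp: D_def)
  qed
  moreover have "(\<Inter>j. D j) = {}"
  proof (rule equals0I)
    fix x assume "x \<in> (\<Inter>j. D j)"
    then have x: "\<And>j. x \<in> D j" by auto
    from x[of i] obtain k where "x \<in> B k i" by (auto simp: D_def)
    moreover have "x \<in> B k j" if "j \<noteq> i" for j using x[of j] that by (auto simp: D_def)
    ultimately have "x \<in> B k j" for j by (cases "j = i") auto
    then show False using B(3) by blast
  qed
  ultimately show ?thesis unfolding borel_separable_def by blast
qed

text \<open>Refining an inseparable sequence digit by digit yields a limit code. If two strands of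
  it had different images, continuity would put late pieces into disjoint open sets, making them
  separable. So all images agree, and the common point lies in every \<open>A i\<close>.\<close>

theorem novikov_separation:
  fixes A :: "nat \<Rightarrow> 'b::t2_space set"
  assumes "\<And>i. analytic (A i)" "(\<Inter>i. A i) = {}"
  shows "borel_separable A"
proof (rule ccontr)
  assume nsep: "\<not> borel_separable A"
  have "\<forall>i. \<exists>F h. closed (F :: baire set) \<and> continuous_on UNIV h \<and> A i = h ` F"
    using assms by (auto simp: analytic_def)
  then obtain F h where Fh: "\<And>i. closed (F i :: baire set)" "\<And>i. continuous_on UNIV (h i)"
    "\<And>i. A i = h i ` F i" by metis
  \<comment> \<open>One point \<open>c\<close> of Baire space codes candidate branches \<open>strand i c\<close> for all \<open>i\<close> at once; fixing
    one more digit of \<open>c\<close> refines a single one of the sets and can be done keeping inseparability.\<close>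
  define N where "N = (\<lambda>c m i. {f. \<forall>j. prod_encode (i, j) < m \<longrightarrow> f j = strand i c j})"
  define S where "S = (\<lambda>c m i. h i ` (F i \<inter> N c m i))"
  have N_cong: "N c m = N c' m" if "\<And>p. p < m \<Longrightarrow> c p = c' p" for c c' m
    using that by (auto simp: N_def strand_def fun_eq_iff)
  have step: "\<exists>k. \<not> borel_separable (S (c(m := k)) (Suc m))" if "\<not> borel_separable (S c m)" for c m
  proof (rule ccontr)
    assume *: "\<not> ?thesis"
    obtain i j where ij: "m = prod_encode (i, j)"
      by (metis surj_pair prod_decode_inverse)
    have same: "N (c(m := k)) (Suc m) i' = N c m i'" if "i' \<noteq> i" for k i'
      using that by (auto simp: N_def strand_def less_Suc_eq ij)
    have new: "N (c(m := k)) (Suc m) i = N c m i \<inter> {f. f j = k}" for k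
      by (auto simp: N_def strand_def less_Suc_eq ij)
    have "S c m i = (\<Union>k. S (c(m := k)) (Suc m) i)"
      unfolding S_def new by auto
    moreover have "(S c m)(i := S (c(m := k)) (Suc m) i) = S (c(m := k)) (Suc m)" for k
      using same by (intro ext) (simp add: S_def)
    ultimately have "borel_separable (S c m)"
      using * by (intro borel_separable_split[where i = i and A = "S c m"
            and A' = "\<lambda>k. S (c(m := k)) (Suc m) i"]) simp_all
    with that show False by blast
  qed
  have "\<exists>cs. \<forall>m. \<not> borel_separable (S (cs m) m) \<and> (\<forall>p<m. cs (Suc m) p = cs m p)"
  proof (rule dependent_nat_choice)
    have "S c 0 = A" for c by (auto simp: S_def N_def Fh(3) fun_eq_iff)
    then show "\<exists>c. \<not> borel_separable (S c 0)" using nsep by simp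
  next
    fix c m assume "\<not> borel_separable (S c m)"
    from step[OF this] obtain k where "\<not> borel_separable (S (c(m := k)) (Suc m))" by blast
    then show "\<exists>c'. \<not> borel_separable (S c' (Suc m)) \<and> (\<forall>p<m. c' p = c p)"
      by (intro exI[of _ "c(m := k)"]) auto
  qed
  then obtain cs where cs: "\<And>m. \<not> borel_separable (S (cs m) m)"
    "\<And>m p. p < m \<Longrightarrow> cs (Suc m) p = cs m p" by metis
  \<comment> \<open>Digit \<open>p\<close> is settled from stage \<open>Suc p\<close> on, so the
    diagonal is the limit of the approximations.\<close>
  define c where "c = (\<lambda>p. cs (Suc p) p)"
  have "cs m p = c p" if "p < m" for m p
    using that by (induction m) (auto simp: cs(2) c_def less_Suc_eq)
  then have "S (cs m) m = S c m" for m
    unfolding S_def by (subst N_cong[of m "cs m" c]) auto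
  with cs(1) have ns: "\<not> borel_separable (S c m)" for m by simp
  have N_small: "\<exists>m. N c m i \<subseteq> U" if U: "open U" "strand i c \<in> U" for i U
  proof -
    obtain k where k: "cyl (map (strand i c) [0..<k]) \<subseteq> U"
      using U by (rule open_contains_cyl)
    \<comment> \<open>The sum bounds each of its terms, so at stage \<open>m\<close> the first
      \<open>k\<close> digits of strand \<open>i\<close> are all fixed.\<close>
    define m where "m = Suc (\<Sum>j<k. prod_encode (i, j))"
    have "prod_encode (i, j) < m" if "j < k" for j
      unfolding m_def using that by (auto intro!: le_imp_less_Suc member_le_sum)
    then have "N c m i \<subseteq> cyl (map (strand i c) [0..<k])"
      by (auto simp: N_def cyl_def)
    with k show ?thesis by blast
  qed
  have N_anti: "N c m' i \<subseteq> N c m i" if "m \<le> m'" for m m' i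
    using that by (auto simp: N_def)
  \<comment> \<open>If the strand left the closed set \<open>F i\<close>, a whole neighbourhood
    would, and a late piece would be empty.\<close>
  have inF: "strand i c \<in> F i" for i
  proof (rule ccontr)
    assume "strand i c \<notin> F i"
    then obtain m where "N c m i \<subseteq> - F i"
      using N_small[of "- F i" i] Fh(1)[of i] by (auto simp: open_Compl)
    then have "S c m i = {}" by (auto simp: S_def)
    then have "borel_separable (S c m)"
      by (intro borel_separableI[of "{}" "{}" _ i i]) simp_all
    with ns show False by blast
  qed
  have "h i (strand i c) = h 0 (strand 0 c)" for i
  proof (rule ccontr)
    assume neq: "\<not> ?thesis"
    obtain U V where UV: "open U" "open V" "h i (strand i c) \<in> U" "h 0 (strand 0 c) \<in> V" "U \<inter> V = {}"
      using hausdorff[OF neq] by blast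
    obtain m where m: "N c m i \<subseteq> h i -` U"
      using N_small[of "h i -` U" i] UV Fh(2)[of i] by (auto intro: open_vimage)
    obtain m' where m': "N c m' 0 \<subseteq> h 0 -` V"
      using N_small[of "h 0 -` V" 0] UV Fh(2)[of 0] by (auto intro: open_vimage)
    have "S c (max m m') i \<subseteq> U" "S c (max m m') 0 \<subseteq> V"
      using m m' N_anti[of m "max m m'" i] N_anti[of m' "max m m'" 0] by (auto simp: S_def)
    then have "borel_separable (S c (max m m'))"
      using UV by (intro borel_separableI[of U V _ i 0]) simp_all
    with ns show False by blast
  qed
  then have "h 0 (strand 0 c) \<in> A i" for i
    using inF[of i] Fh(3)[of i] by (metis imageI)
  with assms(2) show False by blast
qed

text \<open>This is Novikov's theorem for the sequence \<open>A, B, B, ...\<close>: a common point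
  of \<open>D 0\<close> and \<open>B\<close> would lie in every \<open>D i\<close>.\<close>

corollary lusin_separation:
  fixes A B :: "'b::t2_space set"
  assumes "analytic A" "analytic B" "A \<inter> B = {}"
  obtains D where "D \<in> sets borel" "A \<subseteq> D" "D \<inter> B = {}"
proof -
  define Q where "Q = (\<lambda>i::nat. if i = 0 then A else B)"
  have Q: "Q 0 = A" "Q (Suc i) = B" for i by (simp_all add: Q_def)
  have "(\<Inter>i. Q i) \<subseteq> Q 0 \<inter> Q 1" by blast
  then have "(\<Inter>i. Q i) = {}" using assms(3) Q(1) Q(2)[of 0] by simp
  moreover have "analytic (Q i)" for i using assms by (simp add: Q_def)
  ultimately have "borel_separable Q" by (intro novikov_separation)
  then obtain D where D: "\<And>i. D i \<in> sets borel" "\<And>i. Q i \<subseteq> D i" "(\<Inter>i. D i) = {}"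
    unfolding borel_separable_def by metis
  have "D 0 \<inter> B \<subseteq> D i" for i
    using D(2)[of i] Q(2)[of "i - 1"] by (cases i) auto
  then have "D 0 \<inter> B = {}" using D(3) by blast
  then show ?thesis using that[of "D 0"] D(1,2)[of 0] Q(1) by simp
qed

section \<open>The Lusin--Novikov theorem for finite sections\<close>

text \<open>Single-valuedness makes the points of the domain whose value has digit \<open>v\<close>
  at place \<open>n\<close> disjoint from those with another digit there. Both sets are analytic,
  being projections, so a Borel set \<open>D n v\<close> separates them and decides the
  digit.\<close>

lemma borel_partial_function_extend:
  fixes C :: "(baire \<times> baire) set"
  assumes C: "C \<in> sets borel" and single: "\<And>x y y'. (x, y) \<in> C \<Longrightarrow> (x, y') \<in> C \<Longrightarrow> y = y'"
  obtains f where "f \<in> borel_measurable borel" "\<And>x y. (x, y) \<in> C \<Longrightarrow> f x = y"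
proof -
  have snd_cont: "continuous_on UNIV (\<lambda>p::baire \<times> baire. snd p n)" for n
    by (rule continuous_on_compose2[OF continuous_on_product_coordinates continuous_on_snd]) auto
  have ana: "analytic (fst ` (C \<inter> (\<lambda>p. snd p n) -` W))" for n W
    using snd_cont[of n]
    by (intro analytic_image analytic_borel_pair sets.Int[OF C] borel_open open_vimage
        continuous_on_fst continuous_on_id open_discrete)
  have "\<exists>D. D \<in> sets borel \<and> fst ` (C \<inter> (\<lambda>p. snd p n) -` {v}) \<subseteq> D \<and>
          D \<inter> fst ` (C \<inter> (\<lambda>p. snd p n) -` (- {v})) = {}" for n v
  proof -
    have "fst ` (C \<inter> (\<lambda>p. snd p n) -` {v}) \<inter> fst ` (C \<inter> (\<lambda>p. snd p n) -` (- {v})) = {}"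
      using single by fastforce
    from lusin_separation[OF ana ana this] show ?thesis by metis
  qed
  then obtain D where D: "\<And>n v. D n v \<in> sets borel"
    "\<And>n v. fst ` (C \<inter> (\<lambda>p. snd p n) -` {v}) \<subseteq> D n v"
    "\<And>n v. D n v \<inter> fst ` (C \<inter> (\<lambda>p. snd p n) -` (- {v})) = {}" by metis
  \<comment> \<open>Over the domain of \<open>C\<close> exactly one \<open>v\<close> qualifies;
    elsewhere \<open>LEAST\<close> gives an irrelevant but still measurable value.\<close>
  define f where "f = (\<lambda>x n. LEAST v. x \<in> D n v)"
  have [measurable]: "D n v \<in> sets borel" for n v by (rule D)
  have "(\<lambda>x. f x n) \<in> borel_measurable borel" for n
  proof -
    have "(\<lambda>x. f x n) \<in> borel \<rightarrow>\<^sub>M count_space UNIV"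
      unfolding f_def by measurable
    then show ?thesis by (rule measurable_compose) simp
  qed
  then have "f \<in> borel_measurable borel"
    by (rule measurable_coordinatewise_then_product)
  moreover have "f x = y" if "(x, y) \<in> C" for x y
  proof
    fix n
    have "x \<in> D n v \<longleftrightarrow> v = y n" for v
      using that D(2)[of n v] D(3)[of n v] by (force simp: image_iff)
    then show "f x n = y n" by (simp add: f_def Least_equality)
  qed
  ultimately show ?thesis using that by blast
qed

theorem lusin_novikov_finite_baire:
  fixes P :: "(baire \<times> baire) set"
  assumes P: "P \<in> sets borel" and fin: "\<And>x. finite (P `` {x})"
  obtains f :: "nat \<Rightarrow> baire \<Rightarrow> baire"
    where "\<And>k. f k \<in> borel_measurable borel" "\<And>x y. (x, y) \<in> P \<Longrightarrow> \<exists>k. f k x = y"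
proof -
  define U where "U = (\<lambda>n::nat. cyl (from_nat n))"
  \<comment> \<open>\<open>Q n\<close> is the set of \<open>(x, y) \<in> P\<close> for which \<open>y\<close> is not the only member of the section in \<open>U n\<close>.\<close>
  define Q where "Q = (\<lambda>n. P \<inter> snd -` (- U n) \<union>
     (\<lambda>(x, y, y'). (x, y)) ` {(x, y, y'). (x, y) \<in> P \<and> (x, y') \<in> P \<and> y' \<in> U n \<and> y' \<noteq> y})"
  have "analytic (Q n)" for n
  proof -
    let ?p = "\<lambda>(x, y, y'). (x, y) :: baire \<times> baire" and ?q = "\<lambda>(x, y, y'). (x, y') :: baire \<times> baire"
    have p: "continuous_on UNIV ?p" and q: "continuous_on UNIV ?q"
      unfolding case_prod_beta
      by (intro continuous_on_Pair continuous_on_fst continuous_on_snd continuous_on_id)+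
    have "{(x, y, y'). (x, y) \<in> P \<and> (x, y') \<in> P \<and> y' \<in> U n \<and> y' \<noteq> y}
      = ?p -` P \<inter> ?q -` P \<inter> (\<lambda>z. snd (snd z)) -` U n \<inter> {z. snd (snd z) \<noteq> fst (snd z)}"
      by auto
    also have "\<dots> \<in> sets borel"
    proof (intro sets.Int)
      show "?p -` P \<in> sets borel" "?q -` P \<in> sets borel"
        using measurable_sets[OF borel_measurable_continuous_onI[OF p] P]
          measurable_sets[OF borel_measurable_continuous_onI[OF q] P] by simp_all
      show "(\<lambda>z. snd (snd z)) -` U n \<in> sets borel"
        unfolding U_def
        by (intro borel_open open_vimage open_cyl continuous_on_snd continuous_on_id)
      show "{z :: baire \<times> baire \<times> baire. snd (snd z) \<noteq> fst (snd z)} \<in> sets borel"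
        by (rule borel_open, rule open_Collect_neq)
           (intro continuous_on_fst continuous_on_snd continuous_on_id)+
    qed
    finally have "analytic (?p ` {(x, y, y'). (x, y) \<in> P \<and> (x, y') \<in> P \<and> y' \<in> U n \<and> y' \<noteq> y})"
      by (intro analytic_image[OF analytic_borel_triple p])
    moreover have "analytic (P \<inter> snd -` (- U n))"
      unfolding U_def
      by (intro analytic_borel_pair sets.Int[OF P] borel_open open_vimage open_Compl closed_cyl
          continuous_on_snd continuous_on_id)
    ultimately show ?thesis
      unfolding Q_def by (rule analytic_Un[rotated])
  qed
  \<comment> \<open>As the section is finite, a long enough initial segment of \<open>y\<close>
    excludes every other member, so \<open>(x, y)\<close> escapes \<open>Q n\<close> for the index
    \<open>n\<close> of that segment.\<close>
  moreover have "(\<Inter>n. Q n) = {}"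
  proof (rule equals0I, clarify)
    fix x y assume xy: "(x, y) \<in> (\<Inter>n. Q n)"
    let ?R = "P `` {x} - {y}"
    have "\<forall>y'\<in>?R. \<exists>i. y' i \<noteq> y i" by auto
    then obtain g where g: "\<And>y'. y' \<in> ?R \<Longrightarrow> y' (g y') \<noteq> y (g y')" by metis
    have "finite (g ` ?R)" using fin[of x] by auto
    then obtain m where m: "\<And>y'. y' \<in> ?R \<Longrightarrow> g y' < m"
      unfolding finite_nat_set_iff_bounded by auto
    let ?n = "to_nat (map y [0..<m])"
    have yU: "y \<in> U ?n" by (auto simp: U_def cyl_def)
    have "(x, y) \<in> Q ?n" using xy by blast
    with yU obtain y' where "(x, y') \<in> P" "y' \<in> U ?n" "y' \<noteq> y" by (auto simp: Q_def)
    with g[of y'] m[of y'] show False by (auto simp: U_def cyl_def)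
  qed
  ultimately have "borel_separable Q" by (rule novikov_separation)
  then obtain B where B: "\<And>n. B n \<in> sets borel" "\<And>n. Q n \<subseteq> B n" "(\<Inter>n. B n) = {}"
    by (auto simp: borel_separable_def)
  \<comment> \<open>Outside \<open>B n\<close> sections have at most one point: two points would
    both lie in \<open>U n\<close>, and each would witness that the other belongs to
    \<open>Q n\<close>.\<close>
  have "\<exists>f. f \<in> borel_measurable borel \<and> (\<forall>x y. (x, y) \<in> P - B n \<longrightarrow> f x = y)" for n
  proof -
    have "P - B n \<in> sets borel" using P B(1) by auto
    moreover have "y = y'" if "(x, y) \<in> P - B n" "(x, y') \<in> P - B n" for x y y'
    proof (rule ccontr)
      assume neq: "y \<noteq> y'"
      have "(x, y) \<notin> Q n" "(x, y') \<notin> Q n" using that B(2)[of n] by auto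
      then have "y' \<in> U n" using that by (auto simp: Q_def)
      then have "(x, y) \<in> Q n" using that neq by (force simp: Q_def image_iff)
      with \<open>(x, y) \<notin> Q n\<close> show False by blast
    qed
    ultimately show ?thesis by (rule borel_partial_function_extend) blast+
  qed
  then obtain f where f: "\<And>n. f n \<in> borel_measurable borel"
    "\<And>n x y. (x, y) \<in> P - B n \<Longrightarrow> f n x = y" by metis
  show ?thesis
  proof (rule that[of f, OF f(1)])
    fix x y assume "(x, y) \<in> P"
    moreover obtain n where "(x, y) \<notin> B n" using B(3) by blast
    ultimately show "\<exists>k. f k x = y" using f(2) by blast
  qed
qed

section \<open>Transfer from Baire space to standard Borel spaces\<close>

lemma pred_eq_count_space:
  fixes f g :: "'a \<Rightarrow> 'b::countable"
  assumes f: "f \<in> M \<rightarrow>\<^sub>M count_space UNIV" and g: "g \<in> M \<rightarrow>\<^sub>M count_space UNIV"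
  shows "Measurable.pred M (\<lambda>x. f x = g x)"
  by (rule measurable_compose_countable[where f = "\<lambda>v x. f x = v", OF _ g])
     (rule pred_eq_const1[OF f], simp)

lemma measurable_borel_discrete:
  fixes f :: "'a \<Rightarrow> 'b::{countable, t2_space}"
  shows "f \<in> borel_measurable M \<longleftrightarrow> f \<in> M \<rightarrow>\<^sub>M count_space UNIV"
  by (intro arg_cong[where f = "(\<in>) f"] measurable_cong_sets) (simp_all add: sets_borel_eq_count_space)

lemma baire_coordinate_measurable [measurable]:
  "(\<lambda>c::baire. c k) \<in> borel \<rightarrow>\<^sub>M count_space UNIV"
  by (rule measurable_borel_discrete[THEN iffD1, OF measurable_product_coordinates])

lemma measurable_baireI:
  fixes f :: "'a \<Rightarrow> baire"
  assumes "\<And>k. (\<lambda>x. f x k) \<in> M \<rightarrow>\<^sub>M count_space UNIV"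
  shows "f \<in> borel_measurable M"
  by (intro measurable_coordinatewise_then_product measurable_borel_discrete[THEN iffD2] assms)

text \<open>The code of a point is a sequence of indices of ever better approximations in a dense set.\<close>

lemma standard_borel_retract_of_baire:
  assumes "standard_borel M" "space M \<noteq> {}"
  shows "\<exists>(\<phi> :: 'a \<Rightarrow> baire) \<psi>. \<phi> \<in> borel_measurable M \<and> \<psi> \<in> borel \<rightarrow>\<^sub>M M \<and>
           (\<forall>x\<in>space M. \<psi> (\<phi> x) = x)"
proof -
  obtain T where T: "topspace T = space M" "completely_metrizable_space T" "separable_space T"
    "sets M = sigma_sets (space M) {U. openin T U}"
    using assms(1) by (auto simp: standard_borel_def)
  obtain S d where S: "Metric_space S d" "Metric_space.mcomplete S d" "T = Metric_space.mtopology S d"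
    using T(2) by (auto simp: completely_metrizable_space_def)
  interpret Metric_space S d by (rule S(1))
  have SM: "S = space M" using T(1) S(3) by simp
  obtain D where D: "countable D" "D \<subseteq> S" "mtopology closure_of D = S"
    using T(3) S(3) by (auto simp: separable_space_def)
  have "D \<noteq> {}" using D(3) assms(2) SM by auto
  define q where "q = from_nat_into D"
  have range_q: "range q = D" using D(1) \<open>D \<noteq> {}\<close> by (simp add: q_def range_from_nat_into)
  have qS: "q i \<in> S" for i using range_q D(2) by auto
  have dense: "\<exists>i. d x (q i) < e" if e: "x \<in> S" "0 < e" for x e
  proof -
    have "x \<in> mtopology closure_of D" using e D(3) by simp
    then obtain y where "y \<in> D" "d x y < e" using e(2) by (auto simp: metric_closure_of)
    then show ?thesis using range_q by auto
  qed
  define \<epsilon> :: "nat \<Rightarrow> real" where "\<epsilon> k = (1/2) ^ k" for k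
  have \<epsilon>_pos: "\<epsilon> k > 0" for k by (simp add: \<epsilon>_def)
  have \<epsilon>_small: "\<exists>k. \<forall>j\<ge>k. \<epsilon> j < e" if e: "e > 0" for e
  proof -
    obtain k where "\<epsilon> k < e" using real_arch_pow_inv[OF e, of "1/2"] by (auto simp: \<epsilon>_def)
    moreover have "\<epsilon> j \<le> \<epsilon> k" if "k \<le> j" for j
      unfolding \<epsilon>_def using that by (intro power_decreasing) auto
    ultimately show ?thesis by (meson le_less_trans)
  qed
  define \<phi> where "\<phi> x k = (LEAST i. d x (q i) < \<epsilon> k)" for x k
  have \<phi>: "d x (q (\<phi> x k)) < \<epsilon> k" if "x \<in> S" for x k
    unfolding \<phi>_def using dense[OF that \<epsilon>_pos] by (metis (mono_tags, lifting) LeastI)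
  have "Measurable.pred M (\<lambda>x. d x (q i) < \<epsilon> k)" for i k
  proof -
    have "mball (q i) (\<epsilon> k) \<in> sets M"
      unfolding T(4) S(3) by (rule sigma_sets.Basic) simp
    moreover have "mball (q i) (\<epsilon> k) = {x \<in> space M. d x (q i) < \<epsilon> k}"
      using qS[of i] commute[of "q i"] by (auto simp flip: SM)
    ultimately show ?thesis unfolding Measurable.pred_def by simp
  qed
  then have \<phi>_meas: "\<phi> \<in> borel_measurable M"
    by (intro measurable_baireI) (simp add: \<phi>_def)
  \<comment> \<open>These are the codes of rapidly Cauchy sequences. Codes of points satisfy
    \<open>reg\<close> by the triangle inequality, and \<open>reg\<close> is Borel as a countable
    conjunction of conditions on digits.\<close>
  define reg where "reg c \<longleftrightarrow> (\<forall>j k. d (q (c j)) (q (c k)) \<le> \<epsilon> j + \<epsilon> k)" for c :: baire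
  have reg_meas [measurable]: "Measurable.pred borel reg"
    unfolding reg_def by measurable
  have lim: "\<exists>x\<in>S. \<forall>k. d x (q (c k)) \<le> \<epsilon> k" if "reg c" for c
  proof -
    have "MCauchy (\<lambda>k. q (c k))"
      unfolding MCauchy_def
    proof (intro conjI allI impI)
      show "range (\<lambda>k. q (c k)) \<subseteq> S" using qS by auto
      fix e :: real assume "0 < e"
      then obtain N where N: "\<forall>j\<ge>N. \<epsilon> j < e / 2" using \<epsilon>_small[of "e / 2"] by auto
      have "d (q (c m)) (q (c m')) < e" if "N \<le> m" "N \<le> m'" for m m'
      proof -
        have "d (q (c m)) (q (c m')) \<le> \<epsilon> m + \<epsilon> m'" using \<open>reg c\<close> by (simp add: reg_def)
        also have "\<dots> < e / 2 + e / 2" using that N by (intro add_strict_mono) auto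
        finally show ?thesis by simp
      qed
      then show "\<exists>N. \<forall>m m'. N \<le> m \<longrightarrow> N \<le> m' \<longrightarrow> d (q (c m)) (q (c m')) < e" by blast
    qed
    then obtain x where "limitin mtopology (\<lambda>k. q (c k)) x sequentially"
      using S(2) by (auto simp: mcomplete_def)
    then have x: "x \<in> S" "\<And>e. e > 0 \<Longrightarrow> \<exists>N. \<forall>m\<ge>N. d (q (c m)) x < e"
      unfolding limit_metric_sequentially by blast+
    have "d x (q (c k)) \<le> \<epsilon> k" for k
    proof (rule field_le_epsilon)
      fix e :: real assume "0 < e"
      then have "0 < e / 2" by simp
      obtain N where N: "\<forall>m\<ge>N. d (q (c m)) x < e / 2" using x(2)[OF \<open>0 < e / 2\<close>] by auto
      obtain N' where N': "\<forall>j\<ge>N'. \<epsilon> j < e / 2" using \<epsilon>_small[OF \<open>0 < e / 2\<close>] by auto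
      let ?m = "max N N'"
      have "d x (q (c k)) \<le> d x (q (c ?m)) + d (q (c ?m)) (q (c k))"
        using x(1) qS by (intro triangle) auto
      also have "d x (q (c ?m)) \<le> e / 2" using N commute[of x] by (simp add: less_imp_le)
      also have "d (q (c ?m)) (q (c k)) \<le> e / 2 + \<epsilon> k"
        using \<open>reg c\<close> N' unfolding reg_def by (smt (verit) max.cobounded2)
      finally show "d x (q (c k)) \<le> \<epsilon> k + e" by simp
    qed
    with x(1) show ?thesis by blast
  qed
  define \<psi> where "\<psi> c = (if reg c then SOME x. x \<in> S \<and> (\<forall>k. d x (q (c k)) \<le> \<epsilon> k) else q 0)" for c
  have \<psi>: "\<psi> c \<in> S \<and> (\<forall>k. d (\<psi> c) (q (c k)) \<le> \<epsilon> k)" if "reg c" for c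
    using someI_ex[of "\<lambda>x. x \<in> S \<and> (\<forall>k. d x (q (c k)) \<le> \<epsilon> k)"] lim[OF that] that
    by (auto simp: \<psi>_def)
  have \<psi>S: "\<psi> c \<in> S" for c using \<psi>[of c] qS by (cases "reg c") (auto simp: \<psi>_def)
  have "\<psi> (\<phi> x) = x" if "x \<in> space M" for x
  proof -
    have xS: "x \<in> S" using that SM by simp
    have "reg (\<phi> x)"
      unfolding reg_def
    proof (intro allI)
      fix j k
      have "d (q (\<phi> x j)) (q (\<phi> x k)) \<le> d x (q (\<phi> x j)) + d x (q (\<phi> x k))"
        using xS qS by (intro triangle'') auto
      then show "d (q (\<phi> x j)) (q (\<phi> x k)) \<le> \<epsilon> j + \<epsilon> k"
        using \<phi>[OF xS, of j] \<phi>[OF xS, of k] by linarith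
    qed
    note * = \<psi>[OF this]
    have "d (\<psi> (\<phi> x)) x \<le> 0 + e" if e: "e > 0" for e
    proof -
      obtain k where "\<epsilon> k < e / 2" using \<epsilon>_small[of "e / 2"] e by auto
      moreover have "d (\<psi> (\<phi> x)) x \<le> d (\<psi> (\<phi> x)) (q (\<phi> x k)) + d x (q (\<phi> x k))"
        using xS qS * by (intro triangle') auto
      moreover have "d (\<psi> (\<phi> x)) (q (\<phi> x k)) \<le> \<epsilon> k" using * by simp
      ultimately show ?thesis using \<phi>[OF xS, of k] by linarith
    qed
    then have "d (\<psi> (\<phi> x)) x \<le> 0" by (rule field_le_epsilon)
    then show ?thesis using * xS nonneg[of "\<psi> (\<phi> x)" x] zero[of "\<psi> (\<phi> x)" x] by auto
  qed
  moreover have "\<psi> \<in> borel \<rightarrow>\<^sub>M M"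
  proof (rule measurable_sigma_sets[OF T(4)])
    show "{U. openin T U} \<subseteq> Pow (space M)" using openin_subset T(1) by fastforce
    show "\<psi> \<in> space borel \<rightarrow> space M" using \<psi>S SM by auto
  next
    fix U assume "U \<in> {U. openin T U}"
    then have U: "U \<subseteq> S" "\<And>x. x \<in> U \<Longrightarrow> \<exists>r>0. mball x r \<subseteq> U"
      using S(3) by (auto simp: openin_mtopology)
    \<comment> \<open>This reduces \<open>\<psi> c \<in> U\<close> to a countable disjunction of
      conditions on single digits. The factor 2 makes the bound \<open>\<epsilon> k\<close> on the
      distance strict, so that \<open>\<psi> c\<close> lies inside the ball.\<close>
    have reg: "\<psi> c \<in> U \<longleftrightarrow> (\<exists>k. mball (q (c k)) (2 * \<epsilon> k) \<subseteq> U)" if c: "reg c" for c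
    proof
      assume "\<psi> c \<in> U"
      then obtain r where r: "r > 0" "mball (\<psi> c) r \<subseteq> U" using U(2) by blast
      obtain k where k: "\<epsilon> k < r / 3" using \<epsilon>_small[of "r / 3"] r(1) by auto
      have "y \<in> U" if "y \<in> mball (q (c k)) (2 * \<epsilon> k)" for y
      proof -
        have "d (\<psi> c) y \<le> d (\<psi> c) (q (c k)) + d (q (c k)) y"
          using that \<psi>S by (intro triangle) auto
        moreover have "d (\<psi> c) (q (c k)) \<le> \<epsilon> k" using \<psi>[OF c] by simp
        ultimately have "d (\<psi> c) y < r" using that k by auto
        then show ?thesis using r(2) that \<psi>S by auto
      qed
      then show "\<exists>k. mball (q (c k)) (2 * \<epsilon> k) \<subseteq> U" by blast
    next
      assume "\<exists>k. mball (q (c k)) (2 * \<epsilon> k) \<subseteq> U"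
      then obtain k where k: "mball (q (c k)) (2 * \<epsilon> k) \<subseteq> U" by blast
      have "d (q (c k)) (\<psi> c) \<le> \<epsilon> k" using \<psi>[OF c] commute by metis
      also have "\<dots> < 2 * \<epsilon> k" using \<epsilon>_pos[of k] by simp
      finally show "\<psi> c \<in> U" using k \<psi>S qS by auto
    qed
    have nreg: "\<psi> c = q 0" if "\<not> reg c" for c
      using that by (simp add: \<psi>_def)
    have "\<psi> -` U \<inter> space borel =
        {c. reg c \<and> (\<exists>k. mball (q (c k)) (2 * \<epsilon> k) \<subseteq> U) \<or> \<not> reg c \<and> q 0 \<in> U}"
      by (rule set_eqI) (use reg nreg in \<open>simp, metis\<close>)
    also have "\<dots> \<in> sets borel"
    proof -
      define W where "W k i \<longleftrightarrow> mball (q i) (2 * \<epsilon> k) \<subseteq> U" for k i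
      have [measurable]: "Measurable.pred (count_space UNIV) (W k)" for k by simp
      show ?thesis unfolding W_def[symmetric] by measurable
    qed
    finally show "\<psi> -` U \<inter> space borel \<in> sets borel" .
  qed
  ultimately show ?thesis using \<phi>_meas by blast
qed

text \<open>\<open>\<phi>\<close> is injective, so equality of points is agreement of countably many
  measurable digits.\<close>

lemma standard_borel_diagonal:
  assumes "standard_borel M"
  shows "Id_on (space M) \<in> sets (M \<Otimes>\<^sub>M M)"
proof (cases "space M = {}")
  case False
  obtain \<phi> :: "'a \<Rightarrow> baire" and \<psi> where \<phi>: "\<phi> \<in> borel_measurable M"
    and inv: "\<And>x. x \<in> space M \<Longrightarrow> \<psi> (\<phi> x) = x"
    using standard_borel_retract_of_baire[OF assms False] by metis
  define digit where "digit k x = \<phi> x k" for k x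
  have [measurable]: "digit k \<in> M \<rightarrow>\<^sub>M count_space UNIV" for k
    unfolding digit_def by (rule measurable_compose[OF \<phi> baire_coordinate_measurable])
  have inj: "x = y" if "x \<in> space M" "y \<in> space M" "\<forall>k. digit k x = digit k y" for x y
  proof -
    have "\<phi> x = \<phi> y" using that(3) by (intro ext) (simp add: digit_def)
    then have "\<psi> (\<phi> x) = \<psi> (\<phi> y)" by (rule arg_cong)
    then show ?thesis unfolding inv[OF that(1)] inv[OF that(2)] .
  qed
  have "Id_on (space M) = {z \<in> space (M \<Otimes>\<^sub>M M). \<forall>k. digit k (fst z) = digit k (snd z)}"
    by (auto simp: space_pair_measure Id_on_iff intro: inj)
  also have "\<dots> \<in> sets (M \<Otimes>\<^sub>M M)"
    unfolding Measurable.pred_def[symmetric]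
    by (intro pred_intros_countable pred_eq_count_space) measurable
  finally show ?thesis .
qed simp

theorem lusin_novikov_finite:
  assumes M: "standard_borel M" and E: "E \<in> sets (M \<Otimes>\<^sub>M M)"
    and fin: "\<And>x. x \<in> space M \<Longrightarrow> finite (E `` {x})"
  shows "\<exists>f :: nat \<Rightarrow> 'a \<Rightarrow> 'a. (\<forall>k. f k \<in> M \<rightarrow>\<^sub>M M) \<and>
           (\<forall>x\<in>space M. range (\<lambda>k. f k x) = insert x (E `` {x}))"
proof (cases "space M = {}")
  case True
  then show ?thesis by (intro exI[of _ "\<lambda>k x. x"]) auto
next
  case False
  obtain \<phi> :: "'a \<Rightarrow> baire" and \<psi> where [measurable]: "\<phi> \<in> borel_measurable M"
    and [measurable]: "\<psi> \<in> borel \<rightarrow>\<^sub>M M" and inv: "\<And>x. x \<in> space M \<Longrightarrow> \<psi> (\<phi> x) = x"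
    using standard_borel_retract_of_baire[OF M False] by metis
  have coord: "(\<lambda>c. \<phi> (\<psi> c) k) \<in> borel \<rightarrow>\<^sub>M count_space UNIV" for k
    by (rule measurable_compose[OF _ baire_coordinate_measurable]) measurable
  have EV: "E \<subseteq> space M \<times> space M" using sets.sets_into_space[OF E] by (simp add: space_pair_measure)
  \<comment> \<open>Only codes fixed by \<open>\<phi>\<close> after \<open>\<psi>\<close> are kept.
    On these \<open>\<psi>\<close> is injective, so the sections of \<open>P\<close> are as finite
    as those of \<open>E\<close>.\<close>
  define P where "P = {(c, e). (\<forall>k. \<phi> (\<psi> c) k = c k) \<and> (\<forall>k. \<phi> (\<psi> e) k = e k) \<and> (\<psi> c, \<psi> e) \<in> E}"
  have "P \<in> sets borel"
  proof -
    define R where "R = {c. \<forall>k. \<phi> (\<psi> c) k = c k}"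
    have R: "R \<in> sets borel" 
      using pred_intros_countable(1)[OF pred_eq_count_space[OF coord baire_coordinate_measurable]]
      unfolding R_def Measurable.pred_def by simp
    have "(\<lambda>(c, e). (\<psi> c, \<psi> e)) \<in> borel \<Otimes>\<^sub>M borel \<rightarrow>\<^sub>M M \<Otimes>\<^sub>M M" by measurable
    then have "R \<times> R \<inter> ((\<lambda>(c, e). (\<psi> c, \<psi> e)) -` E \<inter> space (borel \<Otimes>\<^sub>M borel)) \<in> sets (borel \<Otimes>\<^sub>M borel)"
      by (rule sets.Int[OF pair_measureI[OF R R] measurable_sets[OF _ E]])
    also have "R \<times> R \<inter> ((\<lambda>(c, e). (\<psi> c, \<psi> e)) -` E \<inter> space (borel \<Otimes>\<^sub>M borel)) = P"
      by (auto simp: P_def R_def space_pair_measure)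
    finally show ?thesis by (simp only: borel_prod)
  qed
  moreover have "finite (P `` {c})" for c
  proof (rule finite_imageD)
    have "\<psi> ` (P `` {c}) \<subseteq> E `` {\<psi> c}" by (auto simp: P_def)
    moreover have "\<psi> c \<in> space M" using measurable_space[of \<psi> borel M c] by simp
    ultimately show "finite (\<psi> ` (P `` {c}))" using fin finite_subset by blast
    show "inj_on \<psi> (P `` {c})"
      by (rule inj_on_inverseI[of _ \<phi>]) (auto simp: P_def)
  qed
  ultimately obtain f where f: "\<And>k::nat. f k \<in> borel_measurable borel"
    "\<And>x y. (x, y) \<in> P \<Longrightarrow> \<exists>k. f k x = y"
    using lusin_novikov_finite_baire by metis
  define F where "F k x = \<psi> (f k (\<phi> x))" for k x
  note [measurable] = f(1) E
  have F [measurable]: "F k \<in> M \<rightarrow>\<^sub>M M" for k unfolding F_def by measurable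
  \<comment> \<open>Index 0 is reserved for the identity, hence the shift. A value that is not a
    neighbour is replaced by \<open>x\<close>, so the ranges are exactly the closed
    neighbourhoods.\<close>
  define g where "g k x = (if k > 0 \<and> (x, F (k - 1) x) \<in> E then F (k - 1) x else x)" for k :: nat and x
  show ?thesis
  proof (intro exI[of _ g] conjI allI ballI)
    show "g k \<in> M \<rightarrow>\<^sub>M M" for k unfolding g_def by measurable
    fix x assume x: "x \<in> space M"
    have "x = g 0 x" by (simp add: g_def)
    moreover have "\<exists>k. y = g k x" if "(x, y) \<in> E" for y
    proof -
      have y: "y \<in> space M" using that EV by auto
      have "(\<phi> x, \<phi> y) \<in> P" using that by (simp add: P_def inv x y)
      then obtain k where "f k (\<phi> x) = \<phi> y" using f(2) by blast
      then have "y = g (Suc k) x" using that by (simp add: g_def F_def inv y)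
      then show ?thesis by blast
    qed
    moreover have "g k x \<in> insert x (E `` {x})" for k by (auto simp: g_def)
    ultimately show "range (\<lambda>k. g k x) = insert x (E `` {x})" by blast
  qed
qed

section \<open>Leftmost solutions on components\<close>

lemma graph_ball_iff_relpow:
  "y \<in> graph_ball V E s x \<longleftrightarrow> y \<in> V \<and> (\<exists>k\<le>s. (x, y) \<in> E ^^ k)"
proof -
  have "Inf {enat k |k. (x, y) \<in> E ^^ k} \<le> enat s \<longleftrightarrow> (\<exists>k\<le>s. (x, y) \<in> E ^^ k)"
  proof
    assume le: "Inf {enat k |k. (x, y) \<in> E ^^ k} \<le> enat s"
    \<comment> \<open>An empty set would have infinite infimum; a nonempty set of extended naturals
      attains its infimum.\<close>
    have "{enat k |k. (x, y) \<in> E ^^ k} \<noteq> {}"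
    proof
      assume "{enat k |k. (x, y) \<in> E ^^ k} = {}"
      then have "Inf {enat k |k. (x, y) \<in> E ^^ k} = \<infinity>" by (simp only: Inf_enat_def) simp
      with le show False by simp
    qed
    then have "Inf {enat k |k. (x, y) \<in> E ^^ k} \<in> {enat k |k. (x, y) \<in> E ^^ k}"
      by (auto simp: Inf_enat_def intro: LeastI)
    with le show "\<exists>k\<le>s. (x, y) \<in> E ^^ k" by auto
  next
    assume "\<exists>k\<le>s. (x, y) \<in> E ^^ k"
    then obtain k where "k \<le> s" "(x, y) \<in> E ^^ k" by blast
    then show "Inf {enat k |k. (x, y) \<in> E ^^ k} \<le> enat s"
      by (intro Inf_lower2[of "enat k"]) auto
  qed
  then show ?thesis by (simp add: graph_ball_def graph_dist_def)
qed

lemma graph_ball_0: "x \<in> V \<Longrightarrow> graph_ball V E 0 x = {x}"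
  by (auto simp: graph_ball_iff_relpow)

text \<open>Splitting off the first edge moves the root, so finiteness and measurability of balls
  follow by induction over all roots at once.\<close>

lemma graph_ball_Suc:
  "graph_ball V E (Suc s) x = (\<Union>z\<in>insert x (E `` {x}). graph_ball V E s z)"
proof (rule set_eqI, rule iffI)
  fix y assume "y \<in> graph_ball V E (Suc s) x"
  then obtain k where k: "y \<in> V" "k \<le> Suc s" "(x, y) \<in> E ^^ k"
    by (auto simp: graph_ball_iff_relpow)
  show "y \<in> (\<Union>z\<in>insert x (E `` {x}). graph_ball V E s z)"
  proof (cases k)
    case 0
    then have "(x, y) \<in> E ^^ 0 \<and> 0 \<le> s" using k by simp
    then have "y \<in> graph_ball V E s x" using k(1) unfolding graph_ball_iff_relpow by blast
    then show ?thesis by blast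
  next
    case (Suc j)
    then obtain z where "(x, z) \<in> E" "(z, y) \<in> E ^^ j" using k(3) relpow_Suc_D2 by metis
    moreover have "j \<le> s" using Suc k(2) by simp
    ultimately have "z \<in> E `` {x}" "y \<in> graph_ball V E s z"
      using k(1) by (auto simp: graph_ball_iff_relpow)
    then show ?thesis by blast
  qed
next
  fix y assume "y \<in> (\<Union>z\<in>insert x (E `` {x}). graph_ball V E s z)"
  then obtain z where z: "z = x \<or> (x, z) \<in> E" "y \<in> graph_ball V E s z" by auto
  then obtain k where k: "y \<in> V" "k \<le> s" "(z, y) \<in> E ^^ k" by (auto simp: graph_ball_iff_relpow)
  have "\<exists>j\<le>Suc s. (x, y) \<in> E ^^ j"
    using z(1) k(2,3) relpow_Suc_I2[of x z E y k] by (metis Suc_le_mono le_SucI)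
  with k(1) show "y \<in> graph_ball V E (Suc s) x" by (simp add: graph_ball_iff_relpow)
qed

lemma measurable_map_count_space:
  fixes h :: "'i \<Rightarrow> 'a \<Rightarrow> 'b::countable"
  assumes "\<And>i. i \<in> set xs \<Longrightarrow> h i \<in> M \<rightarrow>\<^sub>M count_space UNIV"
  shows "(\<lambda>z. map (\<lambda>i. h i z) xs) \<in> M \<rightarrow>\<^sub>M count_space UNIV"
  using assms
proof (induction xs)
  case (Cons i xs)
  have "(\<lambda>z. (\<lambda>ys z. h i z # ys) (map (\<lambda>i. h i z) xs) z) \<in> M \<rightarrow>\<^sub>M count_space UNIV"
  proof (rule measurable_compose_countable[where f = "\<lambda>ys z. h i z # ys"])
    show "(\<lambda>z. map (\<lambda>i. h i z) xs) \<in> M \<rightarrow>\<^sub>M count_space UNIV" using Cons by simp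
    show "(\<lambda>z. h i z # ys) \<in> M \<rightarrow>\<^sub>M count_space UNIV" for ys
      by (rule measurable_compose[of "h i" M "count_space UNIV"]) (use Cons.prems in auto)
  qed
  then show ?case by simp
qed simp

text \<open>On \<open>S\<close> the predicate factors through \<open>h\<close>, so the set is a
  preimage of some set of values, and every set of values is measurable. This handles the arbitrary
  rule \<open>C\<close>.\<close>

lemma sets_Collect_factor_count_space:
  fixes h :: "'a \<Rightarrow> 'b::countable"
  assumes h: "h \<in> M \<rightarrow>\<^sub>M count_space UNIV" and S: "S \<in> sets M"
    and factor: "\<And>x y. x \<in> S \<Longrightarrow> y \<in> S \<Longrightarrow> h x = h y \<Longrightarrow> P x \<Longrightarrow> P y"
  shows "{x \<in> S. P x} \<in> sets M"
proof -
  have "{x \<in> S. P x} = S \<inter> (h -` (h ` {x \<in> S. P x}) \<inter> space M)"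
  proof (intro equalityI subsetI)
    fix x assume "x \<in> S \<inter> (h -` (h ` {x \<in> S. P x}) \<inter> space M)"
    then obtain y where "x \<in> S" "y \<in> S" "P y" "h y = h x" by auto
    then show "x \<in> {x \<in> S. P x}" using factor[of y x] by blast
  qed (use sets.sets_into_space[OF S] in blast)
  also have "\<dots> \<in> sets M" by (rule sets.Int[OF S measurable_sets[OF h]]) simp
  finally show ?thesis .
qed

section \<open>Borel exploration of a component\<close>

locale transversal_lcl =
  fixes M :: "'a measure" and E :: "'a rel" and f :: "nat \<Rightarrow> 'a \<Rightarrow> 'a" and X :: "'a set"
    and l :: "'a \<Rightarrow> nat" and n r :: nat and C :: "('a, nat \<times> nat, bool) rule"
    and sol :: "'a \<Rightarrow> nat"
  assumes graph: "simple_graph (space M) E"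
    and fin: "locally_finite (space M) E"
    and E_sets [measurable]: "E \<in> sets (M \<Otimes>\<^sub>M M)"
    and diag_sets: "Id_on (space M) \<in> sets (M \<Otimes>\<^sub>M M)"
    and f_meas [measurable]: "\<And>k. f k \<in> M \<rightarrow>\<^sub>M M"
    and f_range: "\<And>x. x \<in> space M \<Longrightarrow> range (\<lambda>k. f k x) = insert x (E `` {x})"
    and X_sets [measurable]: "X \<in> sets M"
    and X: "transversal (space M) E X"
    and l_meas [measurable]: "l \<in> M \<rightarrow>\<^sub>M count_space UNIV"
    and C: "local_rule r C"
    and sol: "sol \<in> space M \<rightarrow> {..<n}" "solves C (space M) E l sol"
begin

abbreviation V where "V \<equiv> space M"

abbreviation B where "B s x \<equiv> graph_ball V E s x"

lemma eq_meas [measurable (raw)]: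
  assumes "g \<in> N \<rightarrow>\<^sub>M M" "h \<in> N \<rightarrow>\<^sub>M M"
  shows "Measurable.pred N (\<lambda>x. g x = h x)"
proof -
  have "{x \<in> space N. g x = h x} = (\<lambda>x. (g x, h x)) -` Id_on V \<inter> space N"
    using measurable_space[OF assms(1)] measurable_space[OF assms(2)] by (auto simp: Id_on_iff)
  also have "\<dots> \<in> sets N"
    using assms by (intro measurable_sets[OF _ diag_sets]) measurable
  finally show ?thesis by (simp add: Measurable.pred_def)
qed

lemma f_V [simp]: "x \<in> V \<Longrightarrow> f k x \<in> V"
  using measurable_space[OF f_meas] by blast

lemma edge_V: "(x, y) \<in> E \<Longrightarrow> y \<in> V"
  using graph by (auto simp: simple_graph_def)

lemma ball_finite: "x \<in> V \<Longrightarrow> finite (B s x)"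
proof (induction s arbitrary: x)
  case (Suc s)
  then show ?case
    using fin by (auto simp: graph_ball_Suc locally_finite_def intro: edge_V)
qed (simp add: graph_ball_0)

lemma ball_meas [measurable (raw)]:
  assumes "g \<in> N \<rightarrow>\<^sub>M M" "h \<in> N \<rightarrow>\<^sub>M M"
  shows "Measurable.pred N (\<lambda>x. h x \<in> B s (g x))"
  using assms
proof (induction s arbitrary: g)
  case 0
  have "h x \<in> B 0 (g x) \<longleftrightarrow> h x = g x" if "x \<in> space N" for x
    using measurable_space[OF 0(1) that] by (auto simp: graph_ball_0)
  then show ?case
    using eq_meas[OF 0(2,1)] by (subst measurable_cong) auto
next
  case (Suc s)
  have "h x \<in> B (Suc s) (g x) \<longleftrightarrow> (\<exists>k. h x \<in> B s (f k (g x)))" if "x \<in> space N" for x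
    using f_range[OF measurable_space[OF Suc(2) that], symmetric]
    by (auto simp: graph_ball_Suc)
  moreover have "Measurable.pred N (\<lambda>x. \<exists>k. h x \<in> B s (f k (g x)))"
  proof (rule pred_intros_countable(2))
    fix k
    have "(\<lambda>x. f k (g x)) \<in> N \<rightarrow>\<^sub>M M" using Suc(2) by measurable
    then show "Measurable.pred N (\<lambda>x. h x \<in> B s (f k (g x)))" by (rule Suc.IH[OF _ Suc(3)])
  qed
  ultimately show ?case by (subst measurable_cong) auto
qed

text \<open>\<open>i\<close> codes a finite list of moves, applied in order. Countably many Borel
  maps thus exhaust each component, with repetitions.\<close>

definition walk :: "nat \<Rightarrow> 'a \<Rightarrow> 'a" where
  "walk i = fold f (from_nat i)"

lemma fold_f_meas: "fold f w \<in> M \<rightarrow>\<^sub>M M"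
  by (induction w) (auto intro: measurable_comp)

lemma walk_meas [measurable]: "walk i \<in> M \<rightarrow>\<^sub>M M"
  by (simp add: walk_def fold_f_meas)

lemma walk_V [simp]: "x \<in> V \<Longrightarrow> walk i x \<in> V"
  using measurable_space[OF walk_meas] by blast

lemma range_walk: "x \<in> V \<Longrightarrow> range (\<lambda>i. walk i x) = E\<^sup>* `` {x}"
proof (intro equalityI subsetI)
  assume x: "x \<in> V"
  have "(x, fold f w x) \<in> E\<^sup>*" for w
    using x
  proof (induction w arbitrary: x)
    case (Cons k w)
    have "f k x \<in> insert x (E `` {x})" using f_range[OF Cons.prems] by blast
    then have "(x, f k x) \<in> E\<^sup>*" by auto
    also have "(f k x, fold f w (f k x)) \<in> E\<^sup>*" using Cons by simp
    finally show ?case by simp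
  qed simp
  then show "y \<in> E\<^sup>* `` {x}" if "y \<in> range (\<lambda>i. walk i x)" for y
    using that by (auto simp: walk_def)
next
  assume x: "x \<in> V"
  fix y assume "y \<in> E\<^sup>* `` {x}"
  then have "(x, y) \<in> E\<^sup>*" by simp
  then have "\<exists>w. fold f w x = y"
    using x
  proof (induction rule: converse_rtrancl_induct)
    case base
    then show ?case by (intro exI[of _ "[]"]) simp
  next
    case (step u v)
    then obtain w where w: "fold f w v = y" using edge_V by blast
    have "v \<in> range (\<lambda>k. f k u)" using f_range[OF step.prems] step.hyps(1) by simp
    then obtain k where "f k u = v" by blast
    with w show ?case by (intro exI[of _ "k # w"]) simp
  qed
  then obtain w where "fold f w x = y" by blast
  then show "y \<in> range (\<lambda>i. walk i x)" by (intro image_eqI[of _ _ "to_nat w"]) (auto simp: walk_def)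
qed

lemma ball_reach: "y \<in> B s x \<Longrightarrow> (x, y) \<in> E\<^sup>*"
  by (auto simp: graph_ball_iff_relpow intro: relpow_imp_rtrancl)

text \<open>Many walks may reach \<open>y\<close>; the least index is its canonical name as seen
  from \<open>z\<close>.\<close>

definition idx :: "'a \<Rightarrow> 'a \<Rightarrow> nat" where
  "idx z y = (LEAST i. walk i z = y)"

lemma walk_idx: "walk i z = y \<Longrightarrow> walk (idx z y) z = y"
  unfolding idx_def by (rule LeastI)

lemma idx_le: "walk i z = y \<Longrightarrow> idx z y \<le> i"
  unfolding idx_def by (rule Least_le)

section \<open>Finite partial assignments and their Borel dependence on the root\<close>

lemma C_cong:
  assumes x: "x \<in> V" and lab: "\<And>y. y \<in> B r x \<Longrightarrow> lab y = lab' y"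
  shows "C V E lab x = C V E lab' x"
proof -
  have "rooted_labelled_iso (B r x) (E \<inter> B r x \<times> B r x) lab x (B r x) (E \<inter> B r x \<times> B r x) lab' x"
    unfolding rooted_labelled_iso_def using lab by (intro exI[of _ id]) auto
  then show ?thesis
    using C graph x unfolding local_rule_def Let_def by blast
qed

text \<open>
  An assignment \<open>p\<close> to the walks from \<open>z\<close> labels the vertex \<open>y\<close> by its value at the least walk
  reaching \<open>y\<close>; the values at other walks are ignored, so no consistency condition is needed.
\<close>

definition covered :: "'a \<Rightarrow> nat \<Rightarrow> nat \<Rightarrow> bool" where
  "covered z k m \<longleftrightarrow> (\<forall>y\<in>B r (walk k z). \<exists>i<m. walk i z = y)"

text \<open>Only vertices whose whole ball has names below \<open>length p\<close> are tested. There
  \<open>p\<close> fixes every label that the rule sees, so the verdict persists in all longer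
  lists.\<close>

definition good :: "'a \<Rightarrow> nat list \<Rightarrow> bool" where
  "good z p \<longleftrightarrow> (\<forall>k<length p. covered z k (length p) \<longrightarrow>
     C V E (\<lambda>y. (l y, p ! idx z y)) (walk k z))"

lemma covered_idx:
  assumes "covered z k m" "y \<in> B r (walk k z)"
  shows "idx z y < m" "walk (idx z y) z = y"
proof -
  obtain i where "i < m" "walk i z = y" using assms unfolding covered_def by blast
  then show "idx z y < m" "walk (idx z y) z = y" using idx_le walk_idx le_less_trans by blast+
qed

text \<open>Coveredness is monotone in the length, and a covered vertex reads only entries of
  \<open>p\<close>. Hence the good lists form a tree.\<close>

lemma good_prefix:
  assumes z: "z \<in> V" and g: "good z (p @ q)"
  shows "good z p"
  unfolding good_def
proof (intro allI impI)
  fix k assume k: "k < length p" and cov: "covered z k (length p)"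
  have "covered z k (length (p @ q))"
    using cov unfolding covered_def by (metis length_append trans_less_add1)
  then have "C V E (\<lambda>y. (l y, (p @ q) ! idx z y)) (walk k z)"
    using g k by (simp add: good_def)
  moreover have "C V E (\<lambda>y. (l y, (p @ q) ! idx z y)) (walk k z) = C V E (\<lambda>y. (l y, p ! idx z y)) (walk k z)"
    using z covered_idx(1)[OF cov] by (intro C_cong) (auto simp: nth_append)
  ultimately show "C V E (\<lambda>y. (l y, p ! idx z y)) (walk k z)" by simp
qed

lemma root_in_ball: "x \<in> V \<Longrightarrow> x \<in> B s x"
  unfolding graph_ball_iff_relpow by (metis IdI le0 relpow.simps(1))

text \<open>A finite table with countably many possible values. If \<open>covered z k m\<close> and
  \<open>k < m\<close>, it determines the labelled ball around \<open>walk k z\<close> up to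
  isomorphism.\<close>

definition pattern :: "nat \<Rightarrow> nat \<Rightarrow> 'a \<Rightarrow> (nat \<times> bool \<times> bool \<times> bool) list" where
  "pattern k m z = map (\<lambda>(i, j). (l (walk i z), walk i z = walk j z, (walk i z, walk j z) \<in> E,
     walk i z \<in> B r (walk k z))) (List.product [0..<m] [0..<m])"

lemma patternD:
  assumes "pattern k m z = pattern k m z'" "i < m" "j < m"
  shows "l (walk i z) = l (walk i z')" "walk i z = walk j z \<longleftrightarrow> walk i z' = walk j z'"
    "(walk i z, walk j z) \<in> E \<longleftrightarrow> (walk i z', walk j z') \<in> E"
    "walk i z \<in> B r (walk k z) \<longleftrightarrow> walk i z' \<in> B r (walk k z')"
  using assms unfolding pattern_def by (force simp: map_eq_conv)+

lemma pattern_meas: "pattern k m \<in> M \<rightarrow>\<^sub>M count_space UNIV"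
proof -
  have "(\<lambda>z. (l (walk i z), walk i z = walk j z, (walk i z, walk j z) \<in> E, walk i z \<in> B r (walk k z)))
      \<in> M \<rightarrow>\<^sub>M count_space UNIV" for i j
  proof (subst measurable_count_space_eq2_countable, intro conjI ballI)
    fix t :: "nat \<times> bool \<times> bool \<times> bool"
    obtain a b c d where t: "t = (a, b, c, d)" by (metis surj_pair)
    have "{z \<in> space M. l (walk i z) = a \<and> (walk i z = walk j z) = b \<and>
        ((walk i z, walk j z) \<in> E) = c \<and> (walk i z \<in> B r (walk k z)) = d} \<in> sets M"
      by measurable
    also have "{z \<in> space M. l (walk i z) = a \<and> (walk i z = walk j z) = b \<and>
        ((walk i z, walk j z) \<in> E) = c \<and> (walk i z \<in> B r (walk k z)) = d} =
      (\<lambda>z. (l (walk i z), walk i z = walk j z, (walk i z, walk j z) \<in> E, walk i z \<in> B r (walk k z)))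
        -` {t} \<inter> space M"
      by (auto simp: t)
    finally show "(\<lambda>z. (l (walk i z), walk i z = walk j z, (walk i z, walk j z) \<in> E,
        walk i z \<in> B r (walk k z))) -` {t} \<inter> space M \<in> sets M" .
  qed simp
  then show ?thesis
    unfolding pattern_def by (intro measurable_map_count_space) auto
qed

lemma covered_meas [measurable]: "Measurable.pred M (\<lambda>z. covered z k m)"
proof -
  \<comment> \<open>Every vertex of the ball is itself reached by a walk from \<open>z\<close>, so
    the quantifier over vertices becomes countable.\<close>
  have eq: "covered z k m \<longleftrightarrow> (\<forall>j. walk j z \<in> B r (walk k z) \<longrightarrow> (\<exists>i\<in>{..<m}. walk i z = walk j z))"
    if z: "z \<in> space M" for z
  proof
    assume *: "\<forall>j. walk j z \<in> B r (walk k z) \<longrightarrow> (\<exists>i\<in>{..<m}. walk i z = walk j z)"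
    have "\<exists>j. y = walk j z" if "y \<in> B r (walk k z)" for y
    proof -
      have "(z, walk k z) \<in> E\<^sup>*" using range_walk[OF z] by blast
      also have "(walk k z, y) \<in> E\<^sup>*" using that by (rule ball_reach)
      finally show ?thesis using range_walk[OF z] by blast
    qed
    with * show "covered z k m" unfolding covered_def by (metis lessThan_iff)
  qed (auto simp: covered_def)
  have "Measurable.pred M
      (\<lambda>z. \<forall>j. walk j z \<in> B r (walk k z) \<longrightarrow> (\<exists>i\<in>{..<m}. walk i z = walk j z))"
    by measurable
  then show ?thesis by (simp only: eq cong: measurable_cong_simp)
qed

text \<open>Sending each vertex of one ball to the vertex of the same name seen from the other root
  is an isomorphism. The coincidence entries of the pattern preserve least indices, so
  \<open>p\<close> gives corresponding vertices the same label.\<close>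

lemma C_pattern:
  assumes z: "z \<in> V" "z' \<in> V" and k: "k < m" and cov: "covered z k m" "covered z' k m"
    and pat: "pattern k m z = pattern k m z'"
  shows "C V E (\<lambda>y. (l y, p (idx z y))) (walk k z) = C V E (\<lambda>y. (l y, p (idx z' y))) (walk k z')"
proof -
  note P = patternD[OF pat] and I = covered_idx[OF cov(1)] and I' = covered_idx[OF cov(2)]
  let ?B = "B r (walk k z)" and ?B' = "B r (walk k z')"
  define F where "F y = walk (idx z y) z'" for y
  define F' where "F' y = walk (idx z' y) z" for y
  have F: "F y \<in> ?B'" if "y \<in> ?B" for y
    using P(4)[of "idx z y"] I[OF that] that k by (auto simp: F_def)
  have F': "F' y \<in> ?B" if "y \<in> ?B'" for y
    using P(4)[of "idx z' y"] I'[OF that] that k by (auto simp: F'_def)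
  have idx: "idx z' (F y) = idx z y" if y: "y \<in> ?B" for y
  proof (rule antisym)
    show "idx z' (F y) \<le> idx z y" by (rule idx_le) (simp add: F_def)
    have "walk (idx z' (F y)) z' = walk (idx z y) z'" using I'[OF F[OF y]] by (simp add: F_def)
    then have "walk (idx z' (F y)) z = walk (idx z y) z"
      using P(2) I[OF y] I'[OF F[OF y]] by blast
    then show "idx z y \<le> idx z' (F y)" using I(2)[OF y] by (intro idx_le) simp
  qed
  have idx': "idx z (F' y) = idx z' y" if y: "y \<in> ?B'" for y
  proof (rule antisym)
    show "idx z (F' y) \<le> idx z' y" by (rule idx_le) (simp add: F'_def)
    have "walk (idx z (F' y)) z = walk (idx z' y) z" using I[OF F'[OF y]] by (simp add: F'_def)
    then have "walk (idx z (F' y)) z' = walk (idx z' y) z'"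
      using P(2) I'[OF y] I[OF F'[OF y]] by blast
    then show "idx z' y \<le> idx z (F' y)" using I'(2)[OF y] by (intro idx_le) simp
  qed
  have "bij_betw F ?B ?B'"
  proof (rule bij_betwI[where g = F'])
    show "F \<in> ?B \<rightarrow> ?B'" "F' \<in> ?B' \<rightarrow> ?B" using F F' by auto
    show "F' (F y) = y" if "y \<in> ?B" for y using idx[OF that] I(2)[OF that] by (simp add: F'_def)
    show "F (F' y) = y" if "y \<in> ?B'" for y using idx'[OF that] I'(2)[OF that] by (simp add: F_def)
  qed
  moreover have "F (walk k z) = walk k z'"
  proof -
    have root: "walk k z \<in> ?B" using z by (intro root_in_ball) simp
    show ?thesis using P(2)[of "idx z (walk k z)" k] I[OF root] k by (auto simp: F_def)
  qed
  moreover have "(u, v) \<in> E \<inter> ?B \<times> ?B \<longleftrightarrow> (F u, F v) \<in> E \<inter> ?B' \<times> ?B'"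
    if u: "u \<in> ?B" and v: "v \<in> ?B" for u v
    using P(3)[of "idx z u" "idx z v"] I[OF u] I[OF v] F[OF u] F[OF v] u v by (simp add: F_def)
  moreover have "(l (F u), p (idx z' (F u))) = (l u, p (idx z u))" if u: "u \<in> ?B" for u
    using P(1)[of "idx z u" "idx z u"] I[OF u] idx[OF u] by (simp add: F_def)
  ultimately have "rooted_labelled_iso ?B (E \<inter> ?B \<times> ?B) (\<lambda>y. (l y, p (idx z y))) (walk k z)
      ?B' (E \<inter> ?B' \<times> ?B') (\<lambda>y. (l y, p (idx z' y))) (walk k z')"
    unfolding rooted_labelled_iso_def by (intro exI[of _ F]) blast
  then show ?thesis
    using C graph z unfolding local_rule_def Let_def by (meson walk_V)
qed

lemma good_meas [measurable]: "Measurable.pred M (\<lambda>z. good z p)"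
proof -
  let ?m = "length p"
  have *: "{z \<in> {z \<in> space M. covered z k ?m}. C V E (\<lambda>y. (l y, p ! idx z y)) (walk k z)} \<in> sets M"
    if k: "k < ?m" for k
  proof (rule sets_Collect_factor_count_space[OF pattern_meas[of k ?m]])
    show "{z \<in> space M. covered z k ?m} \<in> sets M" by measurable
  qed (use C_pattern[OF _ _ k] in blast)
  have "Measurable.pred M (\<lambda>z. k < ?m \<longrightarrow> covered z k ?m \<longrightarrow>
      C V E (\<lambda>y. (l y, p ! idx z y)) (walk k z))" for k
  proof (cases "k < ?m")
    case True
    have "Measurable.pred M (\<lambda>z. covered z k ?m \<and> C V E (\<lambda>y. (l y, p ! idx z y)) (walk k z))"
      using *[OF True] unfolding Measurable.pred_def by simp
    \<comment> \<open>The verdict of the rule is controlled only on covered roots, so it is kept in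
      conjunction with coveredness.\<close>
    then have "Measurable.pred M (\<lambda>z. covered z k ?m \<longrightarrow>
        covered z k ?m \<and> C V E (\<lambda>y. (l y, p ! idx z y)) (walk k z))"
      by measurable
    then show ?thesis using True by simp
  qed simp
  then show ?thesis unfolding good_def by (rule pred_intros_countable(1))
qed

section \<open>Koenig's lemma and the leftmost branch\<close>

definition extendible :: "'a \<Rightarrow> nat list \<Rightarrow> bool" where
  "extendible z s \<longleftrightarrow> (\<forall>m. \<exists>q. length q = m \<and> set q \<subseteq> {..<n} \<and> good z (s @ q))"

lemma extendible_meas [measurable]: "Measurable.pred M (\<lambda>z. extendible z s)"
  unfolding extendible_def by measurable

text \<open>The given solution, read along the walks, is a good list of every length. It need not be
  measurable: it only shows that the tree is infinite.\<close>

lemma extendible_Nil: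
  assumes z: "z \<in> V"
  shows "extendible z []"
  unfolding extendible_def
proof
  fix m
  let ?q = "map (\<lambda>i. sol (walk i z)) [0..<m]"
  have "good z ?q"
    unfolding good_def
  proof (intro allI impI)
    fix k assume k: "k < length ?q" and cov: "covered z k (length ?q)"
    have "C V E (\<lambda>y. (l y, sol y)) (walk k z)"
      using sol(2) z by (simp add: solves_def)
    moreover have "C V E (\<lambda>y. (l y, sol y)) (walk k z) = C V E (\<lambda>y. (l y, ?q ! idx z y)) (walk k z)"
      using z covered_idx[OF cov] by (intro C_cong) auto
    ultimately show "C V E (\<lambda>y. (l y, ?q ! idx z y)) (walk k z)" by simp
  qed
  moreover have "set ?q \<subseteq> {..<n}" using sol(1) z by auto
  ultimately show "\<exists>q. length q = m \<and> set q \<subseteq> {..<n} \<and> good z ([] @ q)"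
    by (intro exI[of _ ?q]) auto
qed

text \<open>Koenig's lemma. Suppose each child \<open>i\<close> had no descendant \<open>m i\<close>
  levels further down. A descendant of \<open>s\<close> below all these levels, which exists since
  the sum bounds each \<open>m i\<close>, passes through some child, and truncating it gives a
  contradiction.\<close>

lemma extendible_step:
  assumes z: "z \<in> V" and ext: "extendible z s"
  shows "\<exists>i<n. extendible z (s @ [i])"
proof (rule ccontr)
  assume "\<not> ?thesis"
  then have "\<forall>i<n. \<exists>m. \<forall>q. length q = m \<longrightarrow> set q \<subseteq> {..<n} \<longrightarrow> \<not> good z ((s @ [i]) @ q)"
    unfolding extendible_def by blast
  then obtain m where m: "\<And>i q. i < n \<Longrightarrow> length q = m i \<Longrightarrow> set q \<subseteq> {..<n} \<Longrightarrow> \<not> good z ((s @ [i]) @ q)"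
    by metis
  let ?N = "\<Sum>i<n. m i"
  obtain q where q: "length q = Suc ?N" "set q \<subseteq> {..<n}" "good z (s @ q)"
    using ext unfolding extendible_def by blast
  then obtain i q' where q': "q = i # q'" "length q' = ?N" by (cases q) auto
  have i: "i < n" using q q' by auto
  have "m i \<le> ?N" using i by (intro member_le_sum) auto
  then have len: "length (take (m i) q') = m i" using q' by simp
  have "s @ q = ((s @ [i]) @ take (m i) q') @ drop (m i) q'" using q' by simp
  then have "good z ((s @ [i]) @ take (m i) q')" using good_prefix[OF z] q(3) by metis
  moreover have "set (take (m i) q') \<subseteq> {..<n}" using q(2) q'(1) set_take_subset[of "m i" q'] by auto
  ultimately show False using m[OF i len] by blast
qed

text \<open>Always moving to the least extendible child replaces choice by a rule that is measurable
  in \<open>z\<close>.\<close>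

primrec branch :: "'a \<Rightarrow> nat \<Rightarrow> nat list" where
  "branch z 0 = []"
| "branch z (Suc k) = branch z k @ [LEAST i. extendible z (branch z k @ [i])]"

definition val :: "nat \<Rightarrow> 'a \<Rightarrow> nat" where
  "val k z = (LEAST i. extendible z (branch z k @ [i]))"

lemma branch_meas: "(\<lambda>z. branch z k) \<in> M \<rightarrow>\<^sub>M count_space UNIV"
proof (induction k)
  case (Suc k)
  have "(\<lambda>z. (\<lambda>s z. s @ [LEAST i. extendible z (s @ [i])]) (branch z k) z) \<in> M \<rightarrow>\<^sub>M count_space UNIV"
  proof (rule measurable_compose_countable[OF _ Suc])
    show "(\<lambda>z. s @ [LEAST i. extendible z (s @ [i])]) \<in> M \<rightarrow>\<^sub>M count_space UNIV" for s
      by (rule measurable_compose[of "\<lambda>z. LEAST i. extendible z (s @ [i])" M "count_space UNIV"]) auto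
  qed
  then show ?case by simp
qed simp

lemma val_meas [measurable]: "val k \<in> M \<rightarrow>\<^sub>M count_space UNIV"
proof -
  have "(\<lambda>z. (\<lambda>s z. LEAST i. extendible z (s @ [i])) (branch z k) z) \<in> M \<rightarrow>\<^sub>M count_space UNIV"
    by (rule measurable_compose_countable[OF _ branch_meas]) measurable
  then show ?thesis by (simp add: val_def[abs_def])
qed

lemma extendible_branch: "z \<in> V \<Longrightarrow> extendible z (branch z k)"
proof (induction k)
  case (Suc k)
  then have "\<exists>i. extendible z (branch z k @ [i])" using extendible_step by blast
  then show ?case by (auto intro: LeastI)
qed (simp add: extendible_Nil)

lemma val_less:
  assumes "z \<in> V"
  shows "val k z < n"
proof -
  obtain i where "i < n" "extendible z (branch z k @ [i])"
    using extendible_step[OF assms extendible_branch[OF assms]] by blast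
  then show ?thesis unfolding val_def by (meson Least_le le_less_trans)
qed

lemma length_branch [simp]: "length (branch z k) = k"
  by (induction k) auto

lemma branch_nth: "i < k \<Longrightarrow> branch z k ! i = val i z"
  by (induction k) (auto simp: nth_append val_def less_Suc_eq)

lemma good_branch: "z \<in> V \<Longrightarrow> good z (branch z k)"
  using extendible_branch[of z k] unfolding extendible_def by force

section \<open>Representatives and the Borel solution\<close>

definition rep :: "'a \<Rightarrow> 'a" where
  "rep y = walk (LEAST i. walk i y \<in> X) y"

lemma rep_meas [measurable]: "rep \<in> M \<rightarrow>\<^sub>M M"
proof -
  have "(\<lambda>y. (\<lambda>k y. walk k y) (LEAST i. walk i y \<in> X) y) \<in> M \<rightarrow>\<^sub>M M"
    by (rule measurable_compose_countable) measurable
  then show ?thesis by (simp add: rep_def[abs_def])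
qed

lemma reach_sym: "(x, y) \<in> E\<^sup>* \<Longrightarrow> (y, x) \<in> E\<^sup>*"
  using graph by (auto simp: simple_graph_def intro: symD[OF sym_rtrancl])

lemma ex1_representative:
  assumes y: "y \<in> V"
  shows "\<exists>!x. x \<in> X \<and> (y, x) \<in> E\<^sup>*"
proof -
  let ?K = "{(x, y) \<in> V \<times> V. (x, y) \<in> E\<^sup>*} `` {y}"
  have "\<forall>K\<in>graph_components V E. \<exists>!x. x \<in> X \<inter> K"
    using X by (simp add: transversal_def)
  moreover have "?K \<in> graph_components V E"
    unfolding graph_components_def using y by (rule quotientI)
  ultimately have "\<exists>!x. x \<in> X \<inter> ?K" by (rule bspec)
  moreover have "x \<in> X \<inter> ?K \<longleftrightarrow> x \<in> X \<and> (y, x) \<in> E\<^sup>*" for x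
    using X y unfolding transversal_def by auto
  ultimately show ?thesis by simp
qed

lemma rep:
  assumes y: "y \<in> V"
  shows "rep y \<in> X" "(y, rep y) \<in> E\<^sup>*"
proof -
  obtain x where "x \<in> X" "(y, x) \<in> E\<^sup>*" using ex1_representative[OF y] by blast
  then have "\<exists>i. walk i y \<in> X" using range_walk[OF y] by (metis Image_singleton_iff imageE)
  then show "rep y \<in> X" unfolding rep_def by (rule LeastI_ex)
  show "(y, rep y) \<in> E\<^sup>*" unfolding rep_def using range_walk[OF y] by blast
qed

lemma rep_V: "y \<in> V \<Longrightarrow> rep y \<in> V"
  using measurable_space[OF rep_meas] by blast

text \<open>A component meets \<open>X\<close> only once, so \<open>rep\<close> is constant on it
  and all vertices of a ball read the same branch.\<close>

lemma rep_eq: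
  assumes "x \<in> V" "y \<in> V" "(x, y) \<in> E\<^sup>*"
  shows "rep y = rep x"
proof -
  have "(x, rep y) \<in> E\<^sup>*" using assms(3) rep(2)[OF assms(2)] by (rule rtrancl_trans)
  then show ?thesis using ex1_representative[OF assms(1)] rep[OF assms(1)] rep(1)[OF assms(2)] by blast
qed

text \<open>Each vertex reads the leftmost branch of its representative at its own name.\<close>

definition borel_sol :: "'a \<Rightarrow> nat" where
  "borel_sol y = val (idx (rep y) y) (rep y)"

lemma borel_sol_meas: "borel_sol \<in> M \<rightarrow>\<^sub>M count_space {..<n}"
proof -
  have [measurable]: "(\<lambda>y. idx (rep y) y) \<in> M \<rightarrow>\<^sub>M count_space UNIV"
    unfolding idx_def by measurable
  have "(\<lambda>y. (\<lambda>k y. val k (rep y)) (idx (rep y) y) y) \<in> M \<rightarrow>\<^sub>M count_space UNIV"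
    by (rule measurable_compose_countable) measurable
  then have "borel_sol \<in> M \<rightarrow>\<^sub>M count_space UNIV" by (simp add: borel_sol_def[abs_def])
  moreover have "borel_sol \<in> space M \<rightarrow> {..<n}"
    using val_less rep_V by (auto simp: borel_sol_def)
  ultimately show ?thesis by (simp add: measurable_count_space_eq2_countable)
qed

lemma borel_sol_solves: "solves C V E l borel_sol"
  unfolding solves_def
proof
  fix x assume x: "x \<in> V"
  define z where "z = rep x"
  have z: "z \<in> V" using x rep_V by (simp add: z_def)
  have zx: "(z, x) \<in> E\<^sup>*" using rep(2)[OF x] reach_sym by (simp add: z_def)
  have reach: "walk (idx z y) z = y" if "(x, y) \<in> E\<^sup>*" for y
  proof -
    have "(z, y) \<in> E\<^sup>*" using zx that by (rule rtrancl_trans)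
    then obtain i where "walk i z = y" using range_walk[OF z] by (metis Image_singleton_iff imageE)
    then show ?thesis by (rule walk_idx)
  qed
  define k where "k = idx z x"
  have k: "walk k z = x" using reach[of x] by (simp add: k_def)
  \<comment> \<open>By local finiteness some \<open>m\<close> exceeds the names of \<open>x\<close>
    and of its whole ball, so goodness of the branch of length \<open>m\<close> tests the rule at
    \<open>x\<close>.\<close>
  have "finite (insert k (idx z ` B r x))" using ball_finite[OF x] by simp
  then obtain m where m: "\<And>i. i \<in> insert k (idx z ` B r x) \<Longrightarrow> i < m"
    unfolding finite_nat_set_iff_bounded by blast
  have "covered z k m"
    unfolding covered_def k using m reach ball_reach by blast
  then have "C V E (\<lambda>y. (l y, branch z m ! idx z y)) x"
    using good_branch[OF z, of m] m[of k] k by (auto simp: good_def)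
  moreover have "C V E (\<lambda>y. (l y, branch z m ! idx z y)) x = C V E (\<lambda>y. (l y, borel_sol y)) x"
  proof (rule C_cong[OF x])
    fix y assume y: "y \<in> B r x"
    then have "y \<in> V" by (simp add: graph_ball_def)
    then have "rep y = z" using rep_eq[OF x] ball_reach[OF y] by (simp add: z_def)
    then show "(l y, branch z m ! idx z y) = (l y, borel_sol y)"
      using m[of "idx z y"] y by (simp add: borel_sol_def branch_nth)
  qed
  ultimately show "C V E (\<lambda>y. (l y, borel_sol y)) x" by simp
qed

end

theorem theorem5p23:
  fixes M :: "'a measure" and E :: "'a rel" and X :: "'a set"
    and l :: "'a \<Rightarrow> nat" and n :: nat and C :: "('a, nat \<times> nat, bool) rule"
  assumes "borel_graph M E"
    and "locally_finite (space M) E"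
    and "X \<in> sets M"
    and "transversal (space M) E X"
    and "l \<in> M \<rightarrow>\<^sub>M count_space UNIV"
    and "LCL C"
    and "\<exists>a. a \<in> space M \<rightarrow> {..<n} \<and> solves C (space M) E l a"
  shows "\<exists>a. a \<in> M \<rightarrow>\<^sub>M count_space {..<n} \<and> solves C (space M) E l a"
proof -
  have M: "standard_borel M" and graph: "simple_graph (space M) E" and E: "E \<in> sets (M \<Otimes>\<^sub>M M)"
    using assms(1) by (auto simp: borel_graph_def)
  obtain r where r: "local_rule r C" using assms(6) by (auto simp: LCL_def)
  obtain sol where sol: "sol \<in> space M \<rightarrow> {..<n}" "solves C (space M) E l sol"
    using assms(7) by blast
  have fin: "finite (E `` {x})" if "x \<in> space M" for x
    using assms(2) that by (simp add: locally_finite_def)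
  obtain f :: "nat \<Rightarrow> 'a \<Rightarrow> 'a" where f: "\<And>k. f k \<in> M \<rightarrow>\<^sub>M M"
    "\<And>x. x \<in> space M \<Longrightarrow> range (\<lambda>k. f k x) = insert x (E `` {x})"
    using lusin_novikov_finite[OF M E fin] by metis
  interpret transversal_lcl M E f X l n r C sol
    by unfold_locales
       (fact graph assms E standard_borel_diagonal[OF M] f r sol)+
  show ?thesis using borel_sol_meas borel_sol_solves by blast
qed

end
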